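(* Let $\omega$ be a nonzero real number and $\lambda\in\mathbb{C}$ with $\mathrm{Re}\,\lambda\neq0$. Consider the holomorphic system $$\dot x=i\omega x+f,\quad \dot y=i\omega y+g,\quad \dot z=\lambda z+h,$$ where $f,g,h$ are holomorphic near $0\in\mathbb{C}^3$ and vanish to order at least $2$. Then the system has a unique $(x,y)$-invariant holomorphic center manifold at the origin, and it contains an isochronous center family of period $2\pi/|\omega|$.
   Context: An $(x,y)$-invariant holomorphic center manifold at the origin is a germ at $0$ of a two-dimensional complex submanifold of $\mathbb{C}^3$ through $0$ that is invariant under the system and tangent at $0$ to the $(x,y)$-plane. Such a manifold $S$ contains an isochronous center family of period $T$ if every real-time trajectory of the system starting at a point of $S\setminus\{0\}$ sufficiently close to $0$ is periodic of period $T$. *)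

theory Defs
  imports "HOL-Analysis.Analysis"
begin

type_synonym c3 = "complex \<times> complex \<times> complex"

definition scaleC3 :: "complex \<Rightarrow> c3 \<Rightarrow> c3" where
  "scaleC3 c v = (c * fst v, c * fst (snd v), c * snd (snd v))"

definition cplx_linear :: "(c3 \<Rightarrow> complex) \<Rightarrow> bool" where
  "cplx_linear L \<longleftrightarrow> linear L \<and> (\<forall>c v. L (scaleC3 c v) = c * L v)"

definition holo3 :: "(c3 \<Rightarrow> complex) \<Rightarrow> c3 set \<Rightarrow> bool" where
  "holo3 F U \<longleftrightarrow> open U \<and>
     (\<forall>p\<in>U. \<exists>L. (F has_derivative L) (at p) \<and> cplx_linear L)"

definition vanish_order2 :: "(c3 \<Rightarrow> complex) \<Rightarrow> bool" where
  "vanish_order2 F \<longleftrightarrow> F 0 = 0 \<and> (F has_derivative (\<lambda>_. 0)) (at 0)"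

definition sysfield :: "real \<Rightarrow> complex \<Rightarrow> (c3 \<Rightarrow> complex) \<Rightarrow> (c3 \<Rightarrow> complex)
    \<Rightarrow> (c3 \<Rightarrow> complex) \<Rightarrow> c3 \<Rightarrow> c3" where
  "sysfield \<omega> lam f g h p =
     (\<i> * of_real \<omega> * fst p + f p,
      \<i> * of_real \<omega> * fst (snd p) + g p,
      lam * snd (snd p) + h p)"

text \<open>S (a representative of a germ at 0) is an (x,y)-invariant holomorphic center
  manifold at 0 for the vector field X (holomorphic on U): near 0, S is a two-dimensional
  complex submanifold through 0, namely the zero set of a holomorphic function Phi with
  nowhere vanishing differential on it, whose tangent plane at 0 is the (x,y)-plane,
  and X is tangent to S at each of its points.\<close>
definition xy_center_manifold :: "c3 set \<Rightarrow> (c3 \<Rightarrow> c3) \<Rightarrow> c3 set \<Rightarrow> bool" where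
  "xy_center_manifold U X S \<longleftrightarrow>
     (\<exists>V \<Phi>. open V \<and> 0 \<in> V \<and> V \<subseteq> U \<and> holo3 \<Phi> V \<and> \<Phi> 0 = 0 \<and>
        S \<inter> V = {p\<in>V. \<Phi> p = 0} \<and>
        (\<forall>p\<in>V. \<Phi> p = 0 \<longrightarrow> frechet_derivative \<Phi> (at p) \<noteq> (\<lambda>_. 0)) \<and>
        (\<forall>v. frechet_derivative \<Phi> (at 0) v = 0 \<longleftrightarrow> snd (snd v) = 0) \<and>
        (\<forall>p\<in>V. \<Phi> p = 0 \<longrightarrow> frechet_derivative \<Phi> (at p) (X p) = 0))"

definition same_germ0 :: "c3 set \<Rightarrow> c3 set \<Rightarrow> bool" where
  "same_germ0 S1 S2 \<longleftrightarrow> (\<exists>W. open W \<and> 0 \<in> W \<and> S1 \<inter> W = S2 \<inter> W)"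

definition trajectory :: "c3 set \<Rightarrow> (c3 \<Rightarrow> c3) \<Rightarrow> c3 \<Rightarrow> (real \<Rightarrow> c3) \<Rightarrow> bool" where
  "trajectory U X p \<gamma> \<longleftrightarrow> \<gamma> 0 = p \<and>
     (\<forall>t. \<gamma> t \<in> U \<and> (\<gamma> has_vector_derivative X (\<gamma> t)) (at t))"

definition periodic_with_period :: "(real \<Rightarrow> c3) \<Rightarrow> real \<Rightarrow> bool" where
  "periodic_with_period \<gamma> T \<longleftrightarrow> T > 0 \<and> (\<forall>t. \<gamma> (t + T) = \<gamma> t) \<and>
     (\<forall>s. 0 < s \<and> s < T \<longrightarrow> \<gamma> s \<noteq> \<gamma> 0)"

definition isochronous_center_family :: "c3 set \<Rightarrow> (c3 \<Rightarrow> c3) \<Rightarrow> c3 set \<Rightarrow> real \<Rightarrow> bool" where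
  "isochronous_center_family U X S T \<longleftrightarrow>
     (\<exists>\<delta>>0. \<forall>p\<in>S. p \<noteq> 0 \<and> norm p < \<delta> \<longrightarrow>
        (\<exists>\<gamma>. trajectory U X p \<gamma>) \<and>
        (\<forall>\<gamma>. trajectory U X p \<gamma> \<longrightarrow> periodic_with_period \<gamma> T))"

end

theory Submission
  imports Defs "HOL-Complex_Analysis.Complex_Analysis"
begin

text \<open>
  After division by \<open>\<i> \<omega>\<close> the linear part has eigenvalues \<open>1, 1, \<mu>\<close> with \<open>\<mu>\<close> not real, so in a
  suitable direction \<open>c\<close> of complex time, \<open>Re c = 1\<close>, the \<open>(x, y)\<close>-plane is contracted in backward time
  while the \<open>z\<close>-axis is not. Picard iteration for the integral equation along the spirals
  \<open>exp (c \<sigma>) u\<close>, \<open>\<sigma> \<le> 0\<close>, gives a holomorphic map \<open>\<Theta>\<close> tangent to the identity which on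
  \<open>z = 0\<close> conjugates \<open>u' = \<i> \<omega> u\<close> to the system: there are no resonances, since \<open>1 \<noteq> n\<close> and
  \<open>\<mu> \<noteq> n\<close> for \<open>n \<ge> 2\<close>. The center manifold is \<open>\<Theta> {z = 0}\<close>, and its trajectories are
  \<open>\<Theta> (exp (\<i> \<omega> t) u)\<close>.

  For uniqueness let \<open>\<Psi> = 0\<close> be another center manifold. The derivative of \<open>\<Psi>\<close> along the field is
  \<open>lam * \<Psi>\<close> up to \<open>\<epsilon> \<bar>\<Psi>\<bar>\<close>, so \<open>w s = \<Psi> (\<Theta> (s u))\<close> is a holomorphic function of one variable with
  \<open>\<bar>\<i> \<omega> s w' - lam * w\<bar> \<le> \<epsilon> \<bar>w\<bar>\<close>. A leading term of order \<open>n\<close> would give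
  \<open>\<bar>\<i> \<omega> n - lam\<bar> \<le> \<epsilon>\<close>, which is impossible for \<open>\<epsilon> < \<bar>Re lam\<bar>\<close>; hence \<open>w = 0\<close>.
\<close>

section \<open>Holomorphy on complex lines\<close>

text \<open>Along real time the points of the plane z = 0 only rotate, so an integral over past time
  has no decay to converge by. In the complex direction \<open>c\<close> the nonlinearity decays
  like exp (2 \<sigma>) as \<sigma> tends to minus infinity, while the kernel exp (- a \<sigma>)
  grows at most like exp (- \<sigma>) if Re a \<le> 1; this covers both a = \<open>c\<close> and the
  exponent of the z-equation. The equation obtained in direction \<open>c\<close> passes to real
  time because the derivative of \<Theta> is complex linear: both sides are multiples by \<kappa> =
  c / (\<i> \<omega>) of the real-time equation.

  \<Theta> is built on a full ball of C^3, although it conjugates only on z = 0. It thus doubles as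
  a chart: the third coordinate of its inverse is the defining function of the manifold.

  Analysis in three variables is reduced to complex lines. A bounded function that is holomorphic on
  every line is holomorphic in the sense of \<open>holo3\<close>, so parameter integrals and uniform
  limits need only one-variable theorems. Cauchy estimates on lines make a second-order term
  Lipschitz with a constant proportional to the radius, and every contraction below draws its
  smallness from this.\<close>

declare split_paired_All [simp del] split_paired_Ex [simp del]

lemma scaleC3_simps [simp]:
  "scaleC3 0 v = 0" "scaleC3 1 v = v" "scaleC3 c 0 = 0"
  "scaleC3 a (scaleC3 b v) = scaleC3 (a * b) v"
  by (auto simp: scaleC3_def zero_prod_def mult.assoc)

lemma scaleC3_add_left: "scaleC3 (a + b) v = scaleC3 a v + scaleC3 b v"
  and scaleC3_add_right: "scaleC3 a (v + w) = scaleC3 a v + scaleC3 a w"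
  and scaleC3_diff_left: "scaleC3 (a - b) v = scaleC3 a v - scaleC3 b v"
  and scaleC3_diff_right: "scaleC3 a (v - w) = scaleC3 a v - scaleC3 a w"
  by (auto simp: scaleC3_def algebra_simps)

lemma scaleC3_of_real: "scaleC3 (of_real t) v = t *\<^sub>R v"
  by (auto simp: scaleC3_def scaleR_conv_of_real prod_eq_iff)

lemma fst_scaleC3 [simp]: "fst (scaleC3 c v) = c * fst v"
  and fst_snd_scaleC3 [simp]: "fst (snd (scaleC3 c v)) = c * fst (snd v)"
  and snd_snd_scaleC3 [simp]: "snd (snd (scaleC3 c v)) = c * snd (snd v)"
  by (auto simp: scaleC3_def)

lemma norm_scaleC3 [simp]: "norm (scaleC3 c v) = norm c * norm v"
proof -
  have "norm (scaleC3 c v) = sqrt ((norm c)\<^sup>2 * ((norm (fst v))\<^sup>2 + ((norm (fst (snd v)))\<^sup>2 + (norm (snd (snd v)))\<^sup>2)))"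
    by (simp add: scaleC3_def norm_prod_def norm_mult power_mult_distrib algebra_simps)
  also have "\<dots> = norm c * norm v"
    by (simp add: norm_prod_def real_sqrt_mult)
  finally show ?thesis .
qed

lemma norm_c3_le: "norm (v :: c3) \<le> norm (fst v) + norm (fst (snd v)) + norm (snd (snd v))"
  using norm_Pair_le[of "fst v" "snd v"] norm_Pair_le[of "fst (snd v)" "snd (snd v)"] by simp

lemma norm_c3_ge:
  "norm (fst v) \<le> norm (v :: c3)" "norm (fst (snd v)) \<le> norm v" "norm (snd (snd v)) \<le> norm v"
  using norm_fst_le[of "fst v" "snd v"] norm_snd_le[of "snd v" "fst v"]
    norm_fst_le[of "fst (snd v)" "snd (snd v)"] norm_snd_le[of "snd (snd v)" "fst (snd v)"]
  by simp_all

lemma continuous_on_scaleC3 [continuous_intros]: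
  "continuous_on S f \<Longrightarrow> continuous_on S g \<Longrightarrow> continuous_on S (\<lambda>x. scaleC3 (f x) (g x))"
  unfolding scaleC3_def by (intro continuous_intros)

lemma scaleC3_line_has_derivative:
  "((\<lambda>s. p + scaleC3 s v) has_derivative (\<lambda>h. scaleC3 h v)) (at s within S)"
  unfolding scaleC3_def
  by (auto intro!: derivative_eq_intros)

text \<open>Gateaux holomorphy on the ball of radius \<open>r\<close>. No continuity in several
  variables is asked for, so integrals and limits inherit the property line by line; a bound
  restores \<open>holo3\<close>.\<close>

definition gholo :: "(c3 \<Rightarrow> complex) \<Rightarrow> real \<Rightarrow> bool" where
  "gholo F r \<longleftrightarrow> (\<forall>p v. (\<lambda>s. F (p + scaleC3 s v)) holomorphic_on {s. norm (p + scaleC3 s v) < r})"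

text \<open>Built on the one-variable \<open>deriv\<close>, so that it can be estimated before
  differentiability in C^3 or additivity in \<open>v\<close> is known.\<close>

definition dirderiv :: "(c3 \<Rightarrow> complex) \<Rightarrow> c3 \<Rightarrow> c3 \<Rightarrow> complex" where
  "dirderiv F p v = deriv (\<lambda>s. F (p + scaleC3 s v)) 0"

lemma open_line_ball: "open {s. norm (p + scaleC3 s v) < r}"
  by (intro open_Collect_less continuous_intros)

lemma line_field_derivative:
  assumes "(F has_derivative L) (at (p + scaleC3 s v))" "cplx_linear L"
  shows "((\<lambda>s. F (p + scaleC3 s v)) has_field_derivative L v) (at s)"
proof -
  have "((\<lambda>s. F (p + scaleC3 s v)) has_derivative (\<lambda>h. L (scaleC3 h v))) (at s)"
    by (rule has_derivative_compose[OF scaleC3_line_has_derivative assms(1)])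
  moreover have "(\<lambda>h. L (scaleC3 h v)) = (*) (L v)"
    using assms(2) by (auto simp: cplx_linear_def mult.commute)
  ultimately show ?thesis by (simp add: has_field_derivative_def)
qed

lemma holo3_dirderiv:
  assumes "holo3 F U" "p \<in> U"
  shows "(F has_derivative dirderiv F p) (at p)" "cplx_linear (dirderiv F p)"
proof -
  obtain L where L: "(F has_derivative L) (at p)" "cplx_linear L"
    using assms by (auto simp: holo3_def)
  have "dirderiv F p v = L v" for v
    unfolding dirderiv_def
    by (rule DERIV_imp_deriv, rule line_field_derivative) (use L in auto)
  hence "dirderiv F p = L" by auto
  thus "(F has_derivative dirderiv F p) (at p)" "cplx_linear (dirderiv F p)"
    using L by auto
qed

lemma holo3_subset: "holo3 F U \<Longrightarrow> V \<subseteq> U \<Longrightarrow> open V \<Longrightarrow> holo3 F V"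
  by (auto simp: holo3_def)

lemma holo3_imp_gholo:
  assumes "holo3 F U" "ball 0 r \<subseteq> U"
  shows "gholo F r"
  unfolding gholo_def
proof (intro allI)
  fix p v
  show "(\<lambda>s. F (p + scaleC3 s v)) holomorphic_on {s. norm (p + scaleC3 s v) < r}"
    unfolding holomorphic_on_open[OF open_line_ball]
  proof (intro ballI)
    fix s assume "s \<in> {s. norm (p + scaleC3 s v) < r}"
    hence "p + scaleC3 s v \<in> U" using assms(2) by auto
    from line_field_derivative[OF holo3_dirderiv[OF assms(1) this]]
    show "\<exists>f'. ((\<lambda>s. F (p + scaleC3 s v)) has_field_derivative f') (at s)" by blast
  qed
qed

lemma holo3_imp_continuous_on: "holo3 F U \<Longrightarrow> continuous_on U F"
  by (meson continuous_at_imp_continuous_on has_derivative_continuous holo3_dirderiv(1))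

lemma gholo_line_derivative:
  assumes "gholo F r" "norm (p + scaleC3 s v) < r"
  shows "((\<lambda>s. F (p + scaleC3 s v)) has_field_derivative dirderiv F (p + scaleC3 s v) v) (at s)"
proof -
  have "(\<lambda>s. F (p + scaleC3 s v)) holomorphic_on {s. norm (p + scaleC3 s v) < r}"
    using assms(1) by (auto simp: gholo_def)
  then have 1: "((\<lambda>s. F (p + scaleC3 s v)) has_field_derivative deriv (\<lambda>s. F (p + scaleC3 s v)) s) (at s)"
    by (rule holomorphic_derivI[OF _ open_line_ball]) (use assms in auto)
  have "((\<lambda>h. F (p + scaleC3 (s + h) v)) has_field_derivative deriv (\<lambda>s. F (p + scaleC3 s v)) s) (at 0)"
    using DERIV_at_within_shift[of "\<lambda>s. F (p + scaleC3 s v)" _ s 0 UNIV] 1 by simp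
  then have "dirderiv F (p + scaleC3 s v) v = deriv (\<lambda>s. F (p + scaleC3 s v)) s"
    unfolding dirderiv_def by (intro DERIV_imp_deriv) (simp add: scaleC3_add_left add.assoc)
  with 1 show ?thesis by simp
qed

lemma dirderiv_scale:
  assumes "gholo F r" "norm p < r"
  shows "dirderiv F p (scaleC3 c v) = c * dirderiv F p v"
proof -
  have "((\<lambda>s. F (p + scaleC3 s v)) has_field_derivative dirderiv F p v) (at (c * 0))"
    using gholo_line_derivative[OF assms(1), of p 0 v] assms by simp
  moreover have "((\<lambda>s. c * s) has_field_derivative c) (at 0)"
    by (auto intro!: derivative_eq_intros)
  ultimately have "((\<lambda>s. F (p + scaleC3 (c * s) v)) has_field_derivative dirderiv F p v * c) (at 0)"
    by (rule DERIV_chain2)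
  then show ?thesis
    unfolding dirderiv_def[of F p "scaleC3 c v"]
    by (intro DERIV_imp_deriv) (simp add: mult.commute)
qed

text \<open>Cauchy's inequality on the disc of radius \<rho> / norm v. There are two functions and
  two base points because it serves twice: with G = 0 to bound a derivative, and with F = G to
  compare derivatives at two points.\<close>

lemma line_Cauchy_estimate:
  assumes "gholo F r" "gholo G r" "0 < \<rho>" "norm p \<le> a" "norm q \<le> a" "a + \<rho> < r"
    and "\<And>w. norm w \<le> \<rho> \<Longrightarrow> norm (F (p + w) - G (q + w)) \<le> M"
  shows "norm (dirderiv F p v - dirderiv G q v) \<le> M / \<rho> * norm v"
proof (cases "v = 0")
  case True
  then show ?thesis by (simp add: dirderiv_def)
next
  case False
  define \<delta> where "\<delta> = \<rho> / norm v"
  have \<delta>: "\<delta> > 0" using False assms by (simp add: \<delta>_def)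
  define g where "g = (\<lambda>s. F (p + scaleC3 s v) - G (q + scaleC3 s v))"
  have small: "norm (scaleC3 s v) \<le> \<rho>" if "norm s \<le> \<delta>" for s
    using that False by (simp add: \<delta>_def field_simps)
  have sub: "norm (x + scaleC3 s v) < r" if "norm s \<le> \<delta>" "norm x \<le> a" for s x
    using small[OF that(1)] that(2) assms(6) norm_triangle_ineq[of x "scaleC3 s v"] by linarith
  have hol: "g holomorphic_on cball 0 \<delta>"
    unfolding g_def
  proof (intro holomorphic_on_diff)
    show "(\<lambda>s. F (p + scaleC3 s v)) holomorphic_on cball 0 \<delta>"
      using assms(1)[unfolded gholo_def, rule_format, of p v] by (rule holomorphic_on_subset) (use sub[OF _ assms(4)] in auto)
    show "(\<lambda>s. G (q + scaleC3 s v)) holomorphic_on cball 0 \<delta>"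
      using assms(2)[unfolded gholo_def, rule_format, of q v] by (rule holomorphic_on_subset) (use sub[OF _ assms(5)] in auto)
  qed
  have "norm ((deriv ^^ 1) g 0) \<le> fact 1 * M / \<delta> ^ 1"
  proof (rule Cauchy_inequality)
    show "g holomorphic_on ball 0 \<delta>" using hol by (rule holomorphic_on_subset) auto
    show "continuous_on (cball 0 \<delta>) g" using hol by (rule holomorphic_on_imp_continuous_on)
    fix x :: complex assume "norm (0 - x) = \<delta>"
    then show "norm (g x) \<le> M" unfolding g_def by (intro assms(7) small) simp
  qed (rule \<delta>)
  moreover have "deriv g 0 = dirderiv F p v - dirderiv G q v"
    using gholo_line_derivative[OF assms(1), of p 0 v] gholo_line_derivative[OF assms(2), of q 0 v]
      assms(3-6) unfolding g_def
    by (intro DERIV_imp_deriv) (auto intro!: derivative_eq_intros)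
  ultimately show ?thesis by (simp add: \<delta>_def)
qed

lemma gholo_const: "gholo (\<lambda>_. k) r"
  by (auto simp: gholo_def)

lemma dirderiv_bound:
  assumes "gholo F r" "0 < \<rho>" "norm p \<le> a" "a + \<rho> < r"
    and M: "\<And>w. norm w \<le> a + \<rho> \<Longrightarrow> norm (F w) \<le> M"
  shows "norm (dirderiv F p v) \<le> M / \<rho> * norm v"
proof -
  have "norm (dirderiv F p v - dirderiv (\<lambda>_. 0) p v) \<le> M / \<rho> * norm v"
  proof (rule line_Cauchy_estimate[OF assms(1) gholo_const assms(2,3,3,4)])
    fix w :: c3 assume "norm w \<le> \<rho>"
    thus "norm (F (p + w) - 0) \<le> M"
      using M[of "p + w"] norm_triangle_ineq[of p w] assms(3) by auto
  qed
  thus ?thesis by (simp add: dirderiv_def)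
qed

lemma line_norm_le:
  fixes p q :: c3
  assumes "norm p \<le> a" "norm q \<le> a" "s \<in> closed_segment 0 (1::complex)"
  shows "norm (p + scaleC3 s (q - p)) \<le> a"
proof -
  obtain t where t: "0 \<le> t" "t \<le> 1" "s = of_real t"
    using assms(3) by (auto simp: closed_segment_def scaleR_conv_of_real)
  have "p + scaleC3 s (q - p) = (1 - t) *\<^sub>R p + t *\<^sub>R q"
    by (simp add: t scaleC3_of_real algebra_simps)
  also have "norm \<dots> \<le> (1 - t) * a + t * a"
    using t assms by (intro order_trans[OF norm_triangle_ineq] add_mono) (auto intro!: mult_left_mono)
  finally show ?thesis by (simp add: algebra_simps)
qed

lemma gholo_Lipschitz:
  assumes "gholo F r" "0 < \<rho>" "a + \<rho> < r"
    and M: "\<And>w. norm w \<le> a + \<rho> \<Longrightarrow> norm (F w) \<le> M"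
    and "norm p \<le> a" "norm q \<le> a"
  shows "norm (F q - F p) \<le> M / \<rho> * norm (q - p)"
proof -
  have "norm (F (p + scaleC3 1 (q - p)) - F (p + scaleC3 0 (q - p))) \<le> M / \<rho> * norm (q - p) * norm (1 - 0 :: complex)"
  proof (rule field_differentiable_bound[of "closed_segment 0 1" _ "\<lambda>s. dirderiv F (p + scaleC3 s (q - p)) (q - p)"])
    fix s :: complex assume s: "s \<in> closed_segment 0 1"
    note n = line_norm_le[OF assms(5,6) s]
    show "norm (dirderiv F (p + scaleC3 s (q - p)) (q - p)) \<le> M / \<rho> * norm (q - p)"
      by (rule dirderiv_bound[OF assms(1,2) n assms(3) M])
    show "((\<lambda>s. F (p + scaleC3 s (q - p))) has_field_derivative dirderiv F (p + scaleC3 s (q - p)) (q - p))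
            (at s within closed_segment 0 1)"
      using gholo_line_derivative[OF assms(1), of p s "q - p"] n assms(2,3)
      by (auto intro: has_field_derivative_at_within)
  qed auto
  thus ?thesis by simp
qed

text \<open>The difference of two translates of \<open>F\<close> is small by the Lipschitz bound,
  and Cauchy's inequality passes this on to its derivative. Each of the two estimates costs a margin
  \<rho> and a factor 1 / \<rho>.\<close>

lemma dirderiv_Lipschitz:
  assumes "gholo F r" "0 < \<rho>" "a + 2 * \<rho> < r"
    and M: "\<And>w. norm w \<le> a + 2 * \<rho> \<Longrightarrow> norm (F w) \<le> M"
    and "norm p \<le> a" "norm q \<le> a"
  shows "norm (dirderiv F p v - dirderiv F q v) \<le> M / \<rho>\<^sup>2 * norm (p - q) * norm v"
proof -
  have "norm (dirderiv F p v - dirderiv F q v) \<le> (M / \<rho> * norm (p - q)) / \<rho> * norm v"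
  proof (rule line_Cauchy_estimate[OF assms(1,1,2,5,6)])
    fix w :: c3 assume w: "norm w \<le> \<rho>"
    have "norm (F (p + w) - F (q + w)) \<le> M / \<rho> * norm ((p + w) - (q + w))"
      by (rule gholo_Lipschitz[OF assms(1,2), of "a + \<rho>"])
        (use assms w norm_triangle_ineq[of p w] norm_triangle_ineq[of q w] in \<open>auto simp: algebra_simps\<close>)
    thus "norm (F (p + w) - F (q + w)) \<le> M / \<rho> * norm (p - q)" by simp
  qed (use assms in auto)
  thus ?thesis by (simp add: power2_eq_square)
qed

text \<open>After subtraction of the linear term, the derivative along the segment from
  \<open>p\<close> to \<open>q\<close> is a difference of directional derivatives, which
  \<open>dirderiv_Lipschitz\<close> controls.\<close>

lemma gholo_remainder:
  assumes "gholo F r" "0 < \<rho>" "a + 2 * \<rho> < r"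
    and M: "\<And>w. norm w \<le> a + 2 * \<rho> \<Longrightarrow> norm (F w) \<le> M"
    and "norm p \<le> a" "norm q \<le> a"
  shows "norm (F q - F p - dirderiv F p (q - p)) \<le> M / \<rho>\<^sup>2 * (norm (q - p))\<^sup>2"
proof -
  have M0: "M \<ge> 0" using M[of p] norm_ge_zero[of "F p"] assms(2,5) by (meson add_increasing2 less_imp_le mult_nonneg_nonneg order_trans zero_le_numeral)
  define g where "g = (\<lambda>s. F (p + scaleC3 s (q - p)) - s * dirderiv F p (q - p))"
  have "norm (g 1 - g 0) \<le> M / \<rho>\<^sup>2 * (norm (q - p))\<^sup>2 * norm (1 - 0 :: complex)"
  proof (rule field_differentiable_bound[of "closed_segment 0 1" _ "\<lambda>s. dirderiv F (p + scaleC3 s (q - p)) (q - p) - dirderiv F p (q - p)"])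
    fix s :: complex assume s: "s \<in> closed_segment 0 1"
    note n = line_norm_le[OF assms(5,6) s]
    have s1: "norm s \<le> 1" using s by (auto simp: closed_segment_def)
    have "norm (dirderiv F (p + scaleC3 s (q - p)) (q - p) - dirderiv F p (q - p))
        \<le> M / \<rho>\<^sup>2 * norm (p + scaleC3 s (q - p) - p) * norm (q - p)"
      by (rule dirderiv_Lipschitz[OF assms(1-3) M n assms(5)])
    also have "\<dots> = norm s * (M / \<rho>\<^sup>2 * (norm (q - p))\<^sup>2)"
      by (simp add: power2_eq_square)
    also have "\<dots> \<le> 1 * (M / \<rho>\<^sup>2 * (norm (q - p))\<^sup>2)"
      using s1 M0 by (intro mult_right_mono) auto
    finally show "norm (dirderiv F (p + scaleC3 s (q - p)) (q - p) - dirderiv F p (q - p)) \<le> M / \<rho>\<^sup>2 * (norm (q - p))\<^sup>2" by simp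
    have "norm (p + scaleC3 s (q - p)) < r" using n assms(2,3) by linarith
    note d = gholo_line_derivative[OF assms(1) this]
    have "(g has_field_derivative dirderiv F (p + scaleC3 s (q - p)) (q - p) - 1 * dirderiv F p (q - p)) (at s)"
      unfolding g_def by (intro DERIV_diff d DERIV_cmult_right DERIV_ident)
    then have "(g has_field_derivative dirderiv F (p + scaleC3 s (q - p)) (q - p) - dirderiv F p (q - p)) (at s)"
      by simp
    then show "(g has_field_derivative dirderiv F (p + scaleC3 s (q - p)) (q - p) - dirderiv F p (q - p))
            (at s within closed_segment 0 1)"
      by (rule has_field_derivative_at_within)
  qed auto
  thus ?thesis by (simp add: g_def algebra_simps)
qed

text \<open>Additivity is what holomorphy on lines does not give at once. Going from
  \<open>p\<close> along e (v + w) directly, or first along e v and then along e w, ends at the same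
  point. Each leg is linear up to O(e^2), so e times the defect \<Delta> is O(e^2), and e tends to
  0.\<close>

lemma dirderiv_add:
  assumes "gholo F r" "norm p < r"
    and M: "\<And>w. norm w < r \<Longrightarrow> norm (F w) \<le> M"
  shows "dirderiv F p (v + w) = dirderiv F p v + dirderiv F p w"
proof -
  \<comment> \<open>A quarter of the distance to the sphere leaves \<open>p\<close> room \<rho> to
    move in and still the margin 2 \<rho> of the remainder estimate.\<close>
  define \<rho> where "\<rho> = (r - norm p) / 4"
  define a where "a = norm p + \<rho>"
  have \<rho>: "\<rho> > 0" "a + 2 * \<rho> < r" "norm p \<le> a" using assms(2) by (auto simp: \<rho>_def a_def field_simps)
  have M': "norm (F w) \<le> M" if "norm w \<le> a + 2 * \<rho>" for w using that M \<rho> by auto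
  define K where "K = M / \<rho>\<^sup>2"
  define \<Delta> where "\<Delta> = dirderiv F p (v + w) - dirderiv F p v - dirderiv F p w"
  define B where "B = K * (norm (v + w))\<^sup>2 + K * (norm v)\<^sup>2 + K * (norm w)\<^sup>2 + K * norm v * norm w"
  have est: "norm \<Delta> \<le> B * e" if e: "0 < e" "e * (norm v + norm w) \<le> \<rho>" for e
  proof -
    let ?s = "complex_of_real e"
    have nv: "norm (scaleC3 ?s v) \<le> \<rho>" "norm (scaleC3 ?s v + scaleC3 ?s w) \<le> \<rho>"
      using e(2) mult_nonneg_nonneg[of e "norm v"] mult_nonneg_nonneg[of e "norm w"] e(1)
        norm_triangle_ineq[of "scaleC3 ?s v" "scaleC3 ?s w"]
      by (simp_all add: distrib_left del: mult_nonneg_nonneg zero_le_mult_iff)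
    have 1: "norm (p + scaleC3 ?s v) \<le> a" "norm (p + scaleC3 ?s v + scaleC3 ?s w) \<le> a"
      using nv norm_triangle_ineq[of p "scaleC3 ?s v"] norm_triangle_ineq[of p "scaleC3 ?s v + scaleC3 ?s w"]
      by (auto simp: a_def add.assoc)
    have R: "norm (F y - F x - dirderiv F x (y - x)) \<le> K * (norm (y - x))\<^sup>2"
      if "norm x \<le> a" "norm y \<le> a" for x y
      unfolding K_def by (rule gholo_remainder[OF assms(1) \<rho>(1,2) M' that])
    have r1: "norm (F (p + scaleC3 ?s v + scaleC3 ?s w) - F p - ?s * dirderiv F p (v + w)) \<le> K * (norm (v + w))\<^sup>2 * e\<^sup>2"
      using R[OF \<rho>(3) 1(2)] e(1) dirderiv_scale[OF assms(1,2), of ?s "v + w"]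
      by (simp add: scaleC3_add_right[symmetric] power_mult_distrib add.assoc mult_ac)
    have r2: "norm (F (p + scaleC3 ?s v) - F p - ?s * dirderiv F p v) \<le> K * (norm v)\<^sup>2 * e\<^sup>2"
      using R[OF \<rho>(3) 1(1)] e(1) dirderiv_scale[OF assms(1,2), of ?s v]
      by (simp add: power_mult_distrib mult_ac)
    have r3: "norm (F (p + scaleC3 ?s v + scaleC3 ?s w) - F (p + scaleC3 ?s v) - ?s * dirderiv F (p + scaleC3 ?s v) w) \<le> K * (norm w)\<^sup>2 * e\<^sup>2"
      using R[OF 1] e(1) dirderiv_scale[OF assms(1), of "p + scaleC3 ?s v" ?s w] 1 \<rho>
      by (simp add: power_mult_distrib mult_ac)
    have "norm (dirderiv F (p + scaleC3 ?s v) w - dirderiv F p w) \<le> K * norm (p + scaleC3 ?s v - p) * norm w"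
      unfolding K_def by (rule dirderiv_Lipschitz[OF assms(1) \<rho>(1,2) M' 1(1) \<rho>(3)])
    then have "norm (?s * (dirderiv F (p + scaleC3 ?s v) w - dirderiv F p w)) \<le> e * (K * (e * norm v) * norm w)"
      using e(1) by (simp add: norm_mult)
    then have r4: "norm (?s * dirderiv F (p + scaleC3 ?s v) w - ?s * dirderiv F p w) \<le> K * norm v * norm w * e\<^sup>2"
      by (simp add: power2_eq_square algebra_simps)
    have "?s * \<Delta> = - (F (p + scaleC3 ?s v + scaleC3 ?s w) - F p - ?s * dirderiv F p (v + w))
       + (F (p + scaleC3 ?s v) - F p - ?s * dirderiv F p v)
       + (F (p + scaleC3 ?s v + scaleC3 ?s w) - F (p + scaleC3 ?s v) - ?s * dirderiv F (p + scaleC3 ?s v) w)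
       + (?s * dirderiv F (p + scaleC3 ?s v) w - ?s * dirderiv F p w)"
      by (simp add: \<Delta>_def algebra_simps)
    also have "norm \<dots> \<le> K * (norm (v + w))\<^sup>2 * e\<^sup>2 + K * (norm v)\<^sup>2 * e\<^sup>2 + K * (norm w)\<^sup>2 * e\<^sup>2 + K * norm v * norm w * e\<^sup>2"
      using r1 r2 r3 r4 by (intro norm_triangle_mono) (simp_all only: norm_minus_cancel)
    also have "\<dots> = e * (B * e)" by (simp add: B_def power2_eq_square algebra_simps)
    finally have "e * norm \<Delta> \<le> e * (B * e)" using e(1) by (simp add: norm_mult)
    thus ?thesis using e(1) by simp
  qed
  have "norm \<Delta> \<le> 0"
  proof (rule tendsto_lowerbound)
    show "((\<lambda>e. B * e) \<longlongrightarrow> 0) (at_right 0)" by (auto intro!: tendsto_eq_intros)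
    have "eventually (\<lambda>e. e * (norm v + norm w) < \<rho>) (at_right 0)"
      by (rule order_tendstoD(2)[of _ 0]) (use \<rho> in \<open>auto intro!: tendsto_eq_intros\<close>)
    then show "eventually (\<lambda>e. norm \<Delta> \<le> B * e) (at_right 0)"
      using eventually_at_right_less[of 0] by eventually_elim (use est in auto)
  qed auto
  thus ?thesis by (simp add: \<Delta>_def algebra_simps)
qed

text \<open>The bound makes the quadratic remainder uniform in the direction, which turns the
  directional derivatives into a Frechet derivative. This is the return from lines to C^3 after each
  integral or limit.\<close>

lemma bounded_gholo_imp_holo3:
  assumes "gholo F r" and M: "\<And>w. norm w < r \<Longrightarrow> norm (F w) \<le> M"
  shows "holo3 F (ball 0 r)"
  unfolding holo3_def
proof (intro conjI ballI exI)
  fix p :: c3 assume "p \<in> ball 0 r"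
  hence p: "norm p < r" by simp
  define \<rho> where "\<rho> = (r - norm p) / 4"
  define a where "a = norm p + \<rho>"
  have \<rho>: "\<rho> > 0" "a + 2 * \<rho> < r" "norm p \<le> a" using p by (auto simp: \<rho>_def a_def field_simps)
  have M': "norm (F w) \<le> M" if "norm w \<le> a + 2 * \<rho>" for w using that M \<rho> by auto
  have lin: "linear (dirderiv F p)"
    using dirderiv_add[OF assms(1) p M] dirderiv_scale[OF assms(1) p]
    by (intro linearI) (auto simp flip: scaleC3_of_real simp: scaleR_conv_of_real)
  then show "cplx_linear (dirderiv F p)"
    using dirderiv_scale[OF assms(1) p] by (auto simp: cplx_linear_def)
  have bl: "bounded_linear (dirderiv F p)" using lin by (simp add: linear_conv_bounded_linear)
  show "(F has_derivative dirderiv F p) (at p)"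
    unfolding has_derivative_iff_norm
  proof (intro conjI bl)
    show "((\<lambda>y. norm (F y - F p - dirderiv F p (y - p)) / norm (y - p)) \<longlongrightarrow> 0) (at p)"
    proof (rule Lim_null_comparison)
      show "((\<lambda>y. M / \<rho>\<^sup>2 * norm (y - p)) \<longlongrightarrow> 0) (at p)"
        using \<rho>(1) by (auto intro!: tendsto_eq_intros)
      have "eventually (\<lambda>y. y \<in> ball p \<rho>) (at p)"
        using \<rho>(1) by (intro eventually_at_in_open') auto
      then show "\<forall>\<^sub>F y in at p. norm (norm (F y - F p - dirderiv F p (y - p)) / norm (y - p)) \<le> M / \<rho>\<^sup>2 * norm (y - p)"
      proof eventually_elim
        case (elim y)
        have "norm y \<le> a"
          using elim norm_triangle_ineq[of p "y - p"] by (auto simp: a_def dist_norm norm_minus_commute)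
        have "norm (F y - F p - dirderiv F p (y - p)) \<le> M / \<rho>\<^sup>2 * (norm (y - p))\<^sup>2"
          by (rule gholo_remainder[OF assms(1) \<rho>(1,2) M' \<rho>(3) \<open>norm y \<le> a\<close>])
        then show ?case by (cases "y = p") (simp_all add: pos_divide_le_eq power2_eq_square mult.assoc)
      qed
    qed
  qed
qed auto

text \<open>Cauchy's estimate with radius \<open>a\<close>: the function is at most C (2 a)^2 on the
  ball of radius 2 a, and division by \<open>a\<close> leaves 4 C a. That this tends to 0 with
  \<open>a\<close> is the smallness used in all later contractions.\<close>

lemma quadratic_Lipschitz:
  assumes "gholo F r" and C: "\<And>w. norm w < r \<Longrightarrow> norm (F w) \<le> C * (norm w)\<^sup>2"
    and "0 \<le> C" "2 * a < r" "norm p \<le> a" "norm q \<le> a"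
  shows "norm (F q - F p) \<le> 4 * C * a * norm (q - p)"
proof (cases "a = 0")
  case True
  then show ?thesis using assms by simp
next
  case False
  then have a: "a > 0" using assms(5) norm_ge_zero[of p] by linarith
  have "norm (F q - F p) \<le> (C * (2 * a)\<^sup>2) / a * norm (q - p)"
  proof (rule gholo_Lipschitz[OF assms(1) a _ _ assms(5,6)])
    fix w :: c3 assume "norm w \<le> a + a"
    then show "norm (F w) \<le> C * (2 * a)\<^sup>2"
      using C[of w] assms(3,4) mult_left_mono[OF power_mono[of "norm w" "2 * a" 2], of C] by auto
  qed (use assms in auto)
  thus ?thesis using a by (simp add: power2_eq_square)
qed

lemma holo3_bounded_near:
  assumes "holo3 F U" "0 \<in> U"
  obtains r M where "r > 0" "M > 0" "ball 0 r \<subseteq> U" "\<And>w. norm w < r \<Longrightarrow> norm (F w) \<le> M"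
proof -
  have oU: "open U" using assms(1) by (simp add: holo3_def)
  then obtain e where e: "e > 0" "ball 0 e \<subseteq> U" using assms(2) open_contains_ball by blast
  have "isCont F 0"
    using holo3_imp_continuous_on[OF assms(1)] oU assms(2) by (simp add: continuous_on_eq_continuous_at)
  then obtain d where d: "d > 0" "\<And>w. norm w < d \<Longrightarrow> norm (F w - F 0) < 1"
    unfolding continuous_at_eps_delta by (auto simp: dist_norm) (metis zero_less_one)
  show ?thesis
  proof (rule that[of "min d e" "norm (F 0) + 1"])
    fix w :: c3 assume "norm w < min d e"
    then show "norm (F w) \<le> norm (F 0) + 1"
      using d(2)[of w] norm_triangle_sub[of "F w" "F 0"] by auto
  qed (use d e in \<open>auto simp: add_nonneg_pos\<close>)
qed

lemma quadratic_bound: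
  assumes "holo3 F U" "0 \<in> U" "F 0 = 0" "(F has_derivative (\<lambda>_. 0)) (at 0)"
  obtains r C where "r > 0" "C > 0" "ball 0 r \<subseteq> U" "\<And>w. norm w < r \<Longrightarrow> norm (F w) \<le> C * (norm w)\<^sup>2"
proof -
  obtain r M where r: "r > 0" "M > 0" "ball 0 r \<subseteq> U" "\<And>w. norm w < r \<Longrightarrow> norm (F w) \<le> M"
    using holo3_bounded_near[OF assms(1,2)] by metis
  note g = holo3_imp_gholo[OF assms(1) r(3)]
  have D0: "dirderiv F 0 = (\<lambda>_. 0)"
    using holo3_dirderiv(1)[OF assms(1,2)] assms(4) has_derivative_unique by blast
  show ?thesis
  proof (rule that[of "r / 4" "M / (r / 4)\<^sup>2"])
    fix w :: c3 assume w: "norm w < r / 4"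
    have "norm (F w - F 0 - dirderiv F 0 (w - 0)) \<le> M / (r / 4)\<^sup>2 * (norm (w - 0))\<^sup>2"
      by (rule gholo_remainder[OF g, of _ "r / 4"]) (use r w in auto)
    thus "norm (F w) \<le> M / (r / 4)\<^sup>2 * (norm w)\<^sup>2" using assms(3) D0 by simp
  qed (use r in auto)
qed

section \<open>Integrals along spirals\<close>

text \<open>The bound, uniform in the parameter, forces both the value and the limit at t = 0 to be
  0. For integrands containing ln t, continuity then has to be checked only for t > 0.\<close>

lemma continuous_on_extend_zero:
  fixes g :: "'a::metric_space \<times> real \<Rightarrow> complex"
  assumes cont: "continuous_on (A \<times> {0<..1}) g"
    and bound: "\<And>x t. x \<in> A \<Longrightarrow> t \<in> {0..1} \<Longrightarrow> norm (g (x, t)) \<le> K * t"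
  shows "continuous_on (A \<times> {0..1}) g"
  unfolding continuous_on_eq_continuous_within
proof
  fix z :: "'a \<times> real" assume z: "z \<in> A \<times> {0..1}"
  obtain x t where xt: "z = (x, t)" "x \<in> A" "0 \<le> t" "t \<le> 1" using z by auto
  show "continuous (at z within A \<times> {0..1}) g"
  proof (cases "t = 0")
    case False
    have "at z within A \<times> {0..1} = at z within A \<times> {0<..1}"
      by (rule at_within_nhd[of _ "UNIV \<times> {0<..}"]) (use xt False in \<open>auto intro: open_Times\<close>)
    then show ?thesis
      using cont xt False by (auto simp: continuous_on_eq_continuous_within)
  next
    case True
    have "(g \<longlongrightarrow> 0) (at z within A \<times> {0..1})"
    proof (rule Lim_null_comparison)
      show "\<forall>\<^sub>F y in at z within A \<times> {0..1}. norm (g y) \<le> K * snd y"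
        unfolding eventually_at_filter by (rule always_eventually) (use bound in auto)
      show "((\<lambda>y. K * snd y) \<longlongrightarrow> 0) (at z within A \<times> {0..1})"
        using xt True by (auto intro!: tendsto_eq_intros)
    qed
    moreover have "g z = 0" using bound[of x 0] xt True by auto
    ultimately show ?thesis by (simp add: continuous_within)
  qed
qed

text \<open>Morera's theorem: the integral over a triangle is exchanged with the integral over t,
  and the inner contour integral vanishes by Cauchy's theorem.\<close>

lemma holomorphic_on_integral_param:
  fixes g :: "complex \<Rightarrow> real \<Rightarrow> complex"
  assumes W: "open W" and cont: "continuous_on (W \<times> {0..1}) (\<lambda>(s, t). g s t)"
    and hol: "\<And>t. t \<in> {0..1} \<Longrightarrow> (\<lambda>s. g s t) holomorphic_on W"
  shows "(\<lambda>s. integral {0..1} (g s)) holomorphic_on W"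
proof (rule analytic_imp_holomorphic, rule Morera_triangle[OF _ W])
  show "continuous_on W (\<lambda>s. integral {0..1} (g s))"
    using integral_continuous_on_param[of W 0 1 g] cont by simp
  fix a b c :: complex
  have swap: "contour_integral (linepath a b) (\<lambda>s. integral {0..1} (g s)) =
        integral {0..1} (\<lambda>t. contour_integral (linepath a b) (\<lambda>s. g s t))"
    and int: "(\<lambda>t. contour_integral (linepath a b) (\<lambda>s. g s t)) integrable_on {0..1}"
    if "closed_segment a b \<subseteq> W" for a b
  proof -
    have lW: "linepath a b x \<in> W" if "x \<in> {0..1}" for x
      using \<open>closed_segment a b \<subseteq> W\<close> that by (metis linepath_in_path subsetD)
    have c1: "continuous_on ({0..1} \<times> {0..1}) (\<lambda>(x, t). g (linepath a b x) t * (b - a))"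
    proof -
      have "continuous_on ({0..1} \<times> {0..1}) (\<lambda>y :: real \<times> real. (linepath a b (fst y), snd y))"
        unfolding linepath_def by (intro continuous_intros)
      then have "continuous_on ({0..1} \<times> {0..1}) (\<lambda>y. (\<lambda>(s, t). g s t) (linepath a b (fst y), snd y))"
        by (rule continuous_on_compose2[OF cont]) (auto simp: lW)
      then show ?thesis by (auto intro!: continuous_intros simp: split_beta)
    qed
    have c2: "continuous_on ({0..1} \<times> {0..1}) (\<lambda>(t, x). g (linepath a b x) t * (b - a))"
    proof -
      have "continuous_on ({0..1} \<times> {0..1}) (\<lambda>y. (\<lambda>(x, t). g (linepath a b x) t * (b - a)) (snd y, fst y))"
        by (rule continuous_on_compose2[OF c1]) (auto intro!: continuous_intros)
      then show ?thesis by (simp add: split_beta)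
    qed
    have eq: "contour_integral (linepath a b) f = integral {0..1} (\<lambda>x. f (linepath a b x) * (b - a))" for f
      by (simp add: contour_integral_integral)
    have "integral (cbox 0 1) (\<lambda>x. integral (cbox 0 1) (\<lambda>t. g (linepath a b x) t * (b - a))) =
          integral (cbox 0 1) (\<lambda>t. integral (cbox 0 1) (\<lambda>x. g (linepath a b x) t * (b - a)))"
      by (rule integral_swap_continuous) (use c1 in \<open>simp add: cbox_Pair_eq\<close>)
    then show "contour_integral (linepath a b) (\<lambda>s. integral {0..1} (g s)) =
        integral {0..1} (\<lambda>t. contour_integral (linepath a b) (\<lambda>s. g s t))"
      by (simp add: eq)
    have "continuous_on {0..1} (\<lambda>t. integral {0..1} (\<lambda>x. g (linepath a b x) t * (b - a)))"
      using integral_continuous_on_param[of "{0..1}" 0 1 "\<lambda>t x. g (linepath a b x) t * (b - a)"] c2 by simp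
    then show "(\<lambda>t. contour_integral (linepath a b) (\<lambda>s. g s t)) integrable_on {0..1}"
      by (simp add: eq integrable_continuous_real)
  qed
  show "convex hull {a, b, c} \<subseteq> W \<longrightarrow>
       contour_integral (linepath a b) (\<lambda>s. integral {0..1} (g s)) +
       contour_integral (linepath b c) (\<lambda>s. integral {0..1} (g s)) +
       contour_integral (linepath c a) (\<lambda>s. integral {0..1} (g s)) = 0"
  proof
    assume hull: "convex hull {a, b, c} \<subseteq> W"
    then have seg: "closed_segment a b \<subseteq> W" "closed_segment b c \<subseteq> W" "closed_segment c a \<subseteq> W"
      by (meson segments_subset_convex_hull order_trans)+
    have "contour_integral (linepath a b) (\<lambda>s. integral {0..1} (g s)) +
       contour_integral (linepath b c) (\<lambda>s. integral {0..1} (g s)) +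
       contour_integral (linepath c a) (\<lambda>s. integral {0..1} (g s)) =
       integral {0..1} (\<lambda>t. contour_integral (linepath a b) (\<lambda>s. g s t) +
         contour_integral (linepath b c) (\<lambda>s. g s t) + contour_integral (linepath c a) (\<lambda>s. g s t))"
      by (simp add: swap int seg integral_add integrable_add)
    also have "\<dots> = integral {0..1} (\<lambda>t::real. 0)"
    proof (rule Henstock_Kurzweil_Integration.integral_cong)
      fix t :: real assume t: "t \<in> {0..1}"
      have h: "(\<lambda>s. g s t) holomorphic_on convex hull {a, b, c}"
        using hol[OF t] hull by (rule holomorphic_on_subset)
      have cs: "continuous_on (closed_segment x y) (\<lambda>s. g s t)" if "closed_segment x y \<subseteq> W" for x y
        using hol[OF t] that holomorphic_on_imp_continuous_on continuous_on_subset by blast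
      have "contour_integral (linepath a b +++ linepath b c +++ linepath c a) (\<lambda>s. g s t) = 0"
        using Cauchy_theorem_triangle[OF h] by (rule contour_integral_unique)
      moreover have "contour_integral (linepath a b +++ linepath b c +++ linepath c a) (\<lambda>s. g s t) =
         contour_integral (linepath a b) (\<lambda>s. g s t) +
         (contour_integral (linepath b c) (\<lambda>s. g s t) + contour_integral (linepath c a) (\<lambda>s. g s t))"
        using seg by (simp add: contour_integrable_joinI contour_integrable_continuous_linepath cs)
      ultimately show "contour_integral (linepath a b) (\<lambda>s. g s t) +
         contour_integral (linepath b c) (\<lambda>s. g s t) + contour_integral (linepath c a) (\<lambda>s. g s t) = 0"
        by (simp add: add.assoc)
    qed
    finally show "contour_integral (linepath a b) (\<lambda>s. integral {0..1} (g s)) +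
       contour_integral (linepath b c) (\<lambda>s. integral {0..1} (g s)) +
       contour_integral (linepath c a) (\<lambda>s. integral {0..1} (g s)) = 0" by simp
  qed
qed

text \<open>The substitution \<open>\<sigma> = 2 ln t\<close> turns the integral of \<open>exp (- a \<sigma>) F (exp (c \<sigma>) u)\<close> over
  \<open>\<sigma> \<le> 0\<close> into an integral over \<open>[0, 1]\<close> with a continuous integrand, since \<open>F\<close> vanishes to
  second order.\<close>

definition spiral_integrand :: "complex \<Rightarrow> complex \<Rightarrow> (c3 \<Rightarrow> complex) \<Rightarrow> c3 \<Rightarrow> real \<Rightarrow> complex" where
  "spiral_integrand c a F u t = (if t = 0 then 0 else
     exp (- 2 * a * complex_of_real (ln t)) * F (scaleC3 (exp (2 * c * complex_of_real (ln t))) u) * (2 / t))"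

definition spiral_integral :: "complex \<Rightarrow> complex \<Rightarrow> (c3 \<Rightarrow> complex) \<Rightarrow> c3 \<Rightarrow> complex" where
  "spiral_integral c a F u = integral {0..1} (spiral_integrand c a F u)"

lemma norm_spiral:
  assumes "Re c = 1" "t > 0"
  shows "norm (exp (2 * c * complex_of_real (ln t))) = t\<^sup>2"
  using assms by (simp add: norm_exp_eq_Re exp_add power2_eq_square)
     (metis exp_add exp_ln mult_2)

lemma spiral_small:
  assumes "Re c = 1" "0 < t" "t \<le> 1"
  shows "norm (scaleC3 (exp (2 * c * complex_of_real (ln t))) u) \<le> norm u"
  using norm_spiral[OF assms(1,2)] assms(2,3) by (simp add: mult_left_le_one_le power_le_one)

text \<open>A count of powers of t: \<open>F\<close> contributes t^4, the exponential at most
  t^(-2), the substitution t^(-1). With \<sigma> = ln t the count would end at t^0; the factor 2 in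
  \<sigma> = 2 ln t leaves t^1, so the default value 0 at t = 0 is the limit.\<close>

lemma spiral_integrand_bound:
  assumes "Re c = 1" "Re a \<le> 1" "0 \<le> t" "t \<le> 1" "norm u < r"
    and F: "\<And>w. norm w < r \<Longrightarrow> norm (F w) \<le> M * (norm w)\<^sup>2"
  shows "norm (spiral_integrand c a F u t) \<le> 2 * M * (norm u)\<^sup>2 * t"
proof (cases "t = 0")
  case True
  then show ?thesis by (simp add: spiral_integrand_def)
next
  case False
  then have t: "t > 0" using assms by simp
  have "norm (F (scaleC3 (exp (2 * c * complex_of_real (ln t))) u)) \<le> M * (norm (scaleC3 (exp (2 * c * complex_of_real (ln t))) u))\<^sup>2"
    using F spiral_small[OF assms(1) t assms(4)] assms(5) by (meson le_less_trans)
  also have "\<dots> = M * (norm u)\<^sup>2 * t ^ 4"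
    unfolding norm_scaleC3 norm_spiral[OF assms(1) t]
    by (simp add: power_mult_distrib flip: power_mult)
  finally have 1: "norm (F (scaleC3 (exp (2 * c * complex_of_real (ln t))) u)) \<le> M * (norm u)\<^sup>2 * t ^ 4" .
  have "Re a * ln t \<ge> 1 * ln t" using t assms by (intro mult_right_mono_neg) auto
  then have "exp (- (2 * Re a * ln t)) \<le> exp (- (2 * ln t))" by simp
  also have "\<dots> = 1 / t\<^sup>2" using t
    by (metis exp_minus exp_ln exp_double inverse_eq_divide)
  finally have 2: "norm (exp (- 2 * a * complex_of_real (ln t))) \<le> 1 / t\<^sup>2" by (simp add: norm_exp_eq_Re)
  have "norm (spiral_integrand c a F u t) =
     norm (exp (- 2 * a * complex_of_real (ln t))) * norm (F (scaleC3 (exp (2 * c * complex_of_real (ln t))) u)) * (2 / t)"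
    using t by (simp add: spiral_integrand_def norm_mult norm_divide)
  also have "\<dots> \<le> 1 / t\<^sup>2 * (M * (norm u)\<^sup>2 * t ^ 4) * (2 / t)"
    using t by (intro mult_right_mono mult_mono 1 2) auto
  also have "\<dots> = 2 * M * (norm u)\<^sup>2 * t" using t by (simp add: field_simps power_numeral_reduce)
  finally show ?thesis .
qed

lemma spiral_integrand_continuous:
  fixes \<phi> :: "'a::metric_space \<Rightarrow> c3"
  assumes "Re c = 1" "Re a \<le> 1" "continuous_on (ball 0 r) F" "0 \<le> M"
    and F: "\<And>w. norm w < r \<Longrightarrow> norm (F w) \<le> M * (norm w)\<^sup>2"
    and "continuous_on A \<phi>" "\<And>x. x \<in> A \<Longrightarrow> norm (\<phi> x) < r"
  shows "continuous_on (A \<times> {0..1}) (\<lambda>(x, t). spiral_integrand c a F (\<phi> x) t)"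
proof (rule continuous_on_extend_zero)
  have "continuous_on (A \<times> {0<..1}) (\<lambda>y. \<phi> (fst y))"
    by (rule continuous_on_compose2[OF assms(6)]) (auto intro!: continuous_intros)
  then have "continuous_on (A \<times> {0<..1}) (\<lambda>y. scaleC3 (exp (2 * c * complex_of_real (ln (snd y)))) (\<phi> (fst y)))"
    by (intro continuous_intros) auto
  then have "continuous_on (A \<times> {0<..1}) (\<lambda>y. F (scaleC3 (exp (2 * c * complex_of_real (ln (snd y)))) (\<phi> (fst y))))"
  proof (rule continuous_on_compose2[OF assms(3)], intro subsetI)
    fix z assume "z \<in> (\<lambda>y. scaleC3 (exp (2 * c * complex_of_real (ln (snd y)))) (\<phi> (fst y))) ` (A \<times> {0<..1})"
    then obtain x t where "z = scaleC3 (exp (2 * c * complex_of_real (ln t))) (\<phi> x)" "x \<in> A" "0 < t" "t \<le> 1"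
      by (auto simp: image_iff)
    then show "z \<in> ball 0 r"
      using spiral_small[OF assms(1), of t "\<phi> x"] assms(7)[of x] by simp
  qed
  then have "continuous_on (A \<times> {0<..1}) (\<lambda>y. exp (- 2 * a * complex_of_real (ln (snd y))) *
     F (scaleC3 (exp (2 * c * complex_of_real (ln (snd y)))) (\<phi> (fst y))) * (2 / snd y))"
    by (intro continuous_intros) auto
  then show "continuous_on (A \<times> {0<..1}) (\<lambda>(x, t). spiral_integrand c a F (\<phi> x) t)"
    by (rule continuous_on_eq) (auto simp: spiral_integrand_def)
  fix x and t :: real assume x: "x \<in> A" and t: "t \<in> {0..1}"
  have "norm (spiral_integrand c a F (\<phi> x) t) \<le> 2 * M * (norm (\<phi> x))\<^sup>2 * t"
    using t by (intro spiral_integrand_bound[OF assms(1,2) _ _ assms(7) F] x) auto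
  also have "\<dots> \<le> 2 * M * r\<^sup>2 * t"
    using assms(4,7) x t by (intro mult_right_mono mult_left_mono power_mono) (auto intro: less_imp_le)
  finally show "norm (case (x, t) of (x, t) \<Rightarrow> spiral_integrand c a F (\<phi> x) t) \<le> 2 * M * r\<^sup>2 * t"
    by simp
qed

lemma spiral_integrand_continuous_t:
  assumes "Re c = 1" "Re a \<le> 1" "continuous_on (ball 0 r) F" "0 \<le> M"
    and F: "\<And>w. norm w < r \<Longrightarrow> norm (F w) \<le> M * (norm w)\<^sup>2" and "norm u < r"
  shows "continuous_on {0..1} (spiral_integrand c a F u)"
proof -
  \<comment> \<open>A one-point parameter space reduces the joint statement to continuity in
    t.\<close>
  have c: "continuous_on ({0::real} \<times> {0..1}) (\<lambda>(x, t). spiral_integrand c a F u t)"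
    by (rule spiral_integrand_continuous[OF assms(1-4) F]) (use assms in auto)
  have "continuous_on {0..1} (\<lambda>t. (\<lambda>(x, t). spiral_integrand c a F u t) (0::real, t))"
    by (rule continuous_on_compose2[OF c]) (auto intro!: continuous_intros)
  then show ?thesis by simp
qed

lemma spiral_integral_bound:
  assumes "Re c = 1" "Re a \<le> 1" "continuous_on (ball 0 r) F" "0 \<le> M"
    and F: "\<And>w. norm w < r \<Longrightarrow> norm (F w) \<le> M * (norm w)\<^sup>2" and "norm u < r"
  shows "norm (spiral_integral c a F u) \<le> M * (norm u)\<^sup>2"
proof -
  have "((\<lambda>t::real. 2 * M * (norm u)\<^sup>2 * t) has_integral (M * (norm u)\<^sup>2 * 1\<^sup>2 - M * (norm u)\<^sup>2 * 0\<^sup>2)) {0..1}"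
    by (rule fundamental_theorem_of_calculus)
       (auto intro!: derivative_eq_intros simp flip: has_real_derivative_iff_has_vector_derivative)
  then have i: "((\<lambda>t::real. 2 * M * (norm u)\<^sup>2 * t) has_integral M * (norm u)\<^sup>2) {0..1}" by simp
  have "norm (spiral_integral c a F u) \<le> integral {0..1} (\<lambda>t. 2 * M * (norm u)\<^sup>2 * t)"
    unfolding spiral_integral_def
  proof (rule Henstock_Kurzweil_Integration.integral_norm_bound_integral)
    show "spiral_integrand c a F u integrable_on {0..1}"
      by (rule integrable_continuous_real, rule spiral_integrand_continuous_t[OF assms])
    fix t :: real assume "t \<in> {0..1}"
    then show "norm (spiral_integrand c a F u t) \<le> 2 * M * (norm u)\<^sup>2 * t"
      by (intro spiral_integrand_bound[OF assms(1,2) _ _ assms(6) F]) auto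
  qed (use i in blast)
  then show ?thesis using i by (simp add: integral_unique)
qed

lemma spiral_integral_diff:
  assumes "Re c = 1" "Re a \<le> 1" "0 \<le> M" "norm u < r"
    and "continuous_on (ball 0 r) F" "\<And>w. norm w < r \<Longrightarrow> norm (F w) \<le> M * (norm w)\<^sup>2"
    and "continuous_on (ball 0 r) G" "\<And>w. norm w < r \<Longrightarrow> norm (G w) \<le> M * (norm w)\<^sup>2"
  shows "spiral_integral c a F u - spiral_integral c a G u = spiral_integral c a (\<lambda>w. F w - G w) u"
proof -
  have "spiral_integrand c a F u integrable_on {0..1}" "spiral_integrand c a G u integrable_on {0..1}"
    using assms by (auto intro!: integrable_continuous_real spiral_integrand_continuous_t[of c a r _ M])
  then have "spiral_integral c a F u - spiral_integral c a G u =
      integral {0..1} (\<lambda>t. spiral_integrand c a F u t - spiral_integrand c a G u t)"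
    by (simp add: spiral_integral_def integral_diff)
  also have "\<dots> = spiral_integral c a (\<lambda>w. F w - G w) u"
    unfolding spiral_integral_def
    by (rule Henstock_Kurzweil_Integration.integral_cong) (auto simp: spiral_integrand_def algebra_simps diff_divide_distrib)
  finally show ?thesis .
qed

text \<open>For fixed t the spiral acts by a complex scalar, which maps complex lines to complex
  lines and does not leave the ball. Hence each integrand is holomorphic in the line
  parameter.\<close>

lemma gholo_spiral_integral:
  assumes "Re c = 1" "Re a \<le> 1" "gholo F r" "0 \<le> M"
    and F: "\<And>w. norm w < r \<Longrightarrow> norm (F w) \<le> M * (norm w)\<^sup>2"
  shows "gholo (spiral_integral c a F) r"
  unfolding gholo_def
proof (intro allI)
  fix p v
  have bd: "norm (F w) \<le> M * r\<^sup>2" if "norm w < r" for w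
    using F[OF that] mult_left_mono[OF power_mono[of "norm w" r 2] assms(4)] that by simp
  have cF: "continuous_on (ball 0 r) F"
    by (rule holo3_imp_continuous_on, rule bounded_gholo_imp_holo3[OF assms(3) bd])
  show "(\<lambda>s. spiral_integral c a F (p + scaleC3 s v)) holomorphic_on {s. norm (p + scaleC3 s v) < r}"
    unfolding spiral_integral_def
  proof (rule holomorphic_on_integral_param[OF open_line_ball])
    show "continuous_on ({s. norm (p + scaleC3 s v) < r} \<times> {0..1})
       (\<lambda>(s, t). spiral_integrand c a F (p + scaleC3 s v) t)"
      by (rule spiral_integrand_continuous[OF assms(1,2) cF assms(4) F]) (auto intro!: continuous_intros)
    fix t :: real assume t: "t \<in> {0..1}"
    show "(\<lambda>s. spiral_integrand c a F (p + scaleC3 s v) t) holomorphic_on {s. norm (p + scaleC3 s v) < r}"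
    proof (cases "t = 0")
      case False
      let ?e = "exp (2 * c * complex_of_real (ln t))"
      have "(\<lambda>s. F (scaleC3 ?e p + scaleC3 s (scaleC3 ?e v))) holomorphic_on {s. norm (p + scaleC3 s v) < r}"
        using assms(3)[unfolded gholo_def, rule_format, of "scaleC3 ?e p" "scaleC3 ?e v"]
      proof (rule holomorphic_on_subset, intro subsetI CollectI)
        fix s assume "s \<in> {s. norm (p + scaleC3 s v) < r}"
        moreover have "scaleC3 ?e p + scaleC3 s (scaleC3 ?e v) = scaleC3 ?e (p + scaleC3 s v)"
          by (simp add: scaleC3_add_right mult.commute)
        ultimately show "norm (scaleC3 ?e p + scaleC3 s (scaleC3 ?e v)) < r"
          using spiral_small[OF assms(1), of t "p + scaleC3 s v"] t False by auto
      qed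
      then show ?thesis
        using False by (auto simp: spiral_integrand_def scaleC3_add_right mult.commute intro!: holomorphic_intros)
    qed (simp add: spiral_integrand_def)
  qed
qed

text \<open>Variation of constants: along the spiral through \<open>u\<close> the integral solves
  dG/d\<sigma> = a G + F, and d/d\<sigma> is \<open>c\<close> times the derivative in direction
  \<open>u\<close>. The proof moves the base point along the spiral, which only rescales the domain
  of integration, and differentiates at the end point.\<close>

lemma spiral_integral_equation:
  assumes "Re c = 1" "Re a \<le> 1" "gholo F r" "0 \<le> M"
    and F: "\<And>w. norm w < r \<Longrightarrow> norm (F w) \<le> M * (norm w)\<^sup>2" and u: "norm u < r"
  shows "c * dirderiv (spiral_integral c a F) u u = a * spiral_integral c a F u + F u"
proof -
  have bd: "norm (F w) \<le> M * r\<^sup>2" if "norm w < r" for w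
    using F[OF that] mult_left_mono[OF power_mono[of "norm w" r 2] assms(4)] that by simp
  have cF: "continuous_on (ball 0 r) F"
    by (rule holo3_imp_continuous_on, rule bounded_gholo_imp_holo3[OF assms(3) bd])
  let ?G = "spiral_integral c a F" and ?J = "spiral_integrand c a F u"
  have cJ: "continuous_on {0..1} ?J"
    by (rule spiral_integrand_continuous_t[OF assms(1,2) cF assms(4) F u])
  have shift: "?G (scaleC3 (exp (2 * c * complex_of_real (ln \<tau>))) u) = exp (2 * a * complex_of_real (ln \<tau>)) * integral {0..\<tau>} ?J"
    if \<tau>: "0 < \<tau>" "\<tau> \<le> 1" for \<tau> :: real
  proof -
    have "((\<lambda>t. \<tau> *\<^sub>R ?J (\<tau> * t)) has_integral (integral {\<tau> * 0..\<tau> * 1} ?J)) {0..1}"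
      using \<tau> by (intro has_integral_substitution[of 0 1 "\<lambda>t. \<tau> * t" 0 1 ?J])
         (auto intro!: cJ derivative_eq_intros mult_le_one)
    then have "((\<lambda>t. exp (2 * a * complex_of_real (ln \<tau>)) * (\<tau> *\<^sub>R ?J (\<tau> * t))) has_integral
        (exp (2 * a * complex_of_real (ln \<tau>)) * integral {0..\<tau>} ?J)) {0..1}"
      by (intro has_integral_mult_right) simp
    moreover have "exp (2 * a * complex_of_real (ln \<tau>)) * (\<tau> *\<^sub>R ?J (\<tau> * t)) =
        spiral_integrand c a F (scaleC3 (exp (2 * c * complex_of_real (ln \<tau>))) u) t" if "t \<in> {0..1}" for t
    proof (cases "t = 0")
      case False
      with that have "t > 0" by simp
      then have l: "complex_of_real (ln (\<tau> * t)) = complex_of_real (ln \<tau>) + complex_of_real (ln t)" using \<tau> by (simp add: ln_mult)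
      have e1: "exp (2 * a * complex_of_real (ln \<tau>)) * exp (- 2 * a * complex_of_real (ln (\<tau> * t))) = exp (- 2 * a * complex_of_real (ln t))"
        unfolding l by (simp add: algebra_simps flip: exp_add)
      have e2: "exp (2 * c * complex_of_real (ln (\<tau> * t))) = exp (2 * c * complex_of_real (ln t)) * exp (2 * c * complex_of_real (ln \<tau>))"
        unfolding l by (simp add: algebra_simps flip: exp_add)
      have "exp (2 * a * complex_of_real (ln \<tau>)) * (\<tau> *\<^sub>R ?J (\<tau> * t)) =
         (exp (2 * a * complex_of_real (ln \<tau>)) * exp (- 2 * a * complex_of_real (ln (\<tau> * t)))) *
           F (scaleC3 (exp (2 * c * complex_of_real (ln (\<tau> * t)))) u) * (\<tau> * (2 / (\<tau> * t)))"
        using \<open>t > 0\<close> \<tau> by (simp add: spiral_integrand_def scaleR_conv_of_real)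
      then show ?thesis
        unfolding e1 e2 using \<open>t > 0\<close> \<tau> by (simp add: spiral_integrand_def)
    qed (simp add: spiral_integrand_def)
    ultimately have "(spiral_integrand c a F (scaleC3 (exp (2 * c * complex_of_real (ln \<tau>))) u) has_integral
        exp (2 * a * complex_of_real (ln \<tau>)) * integral {0..\<tau>} ?J) {0..1}"
      by (rule has_integral_eq[rotated])
    then show ?thesis
      unfolding spiral_integral_def by (rule integral_unique)
  qed
  have "((\<lambda>s. ?G (0 + scaleC3 s u)) has_field_derivative dirderiv ?G (0 + scaleC3 1 u) u) (at 1)"
    by (rule gholo_line_derivative[OF gholo_spiral_integral[OF assms(1-4) F]]) (use u in auto)
  then have g: "((\<lambda>s. ?G (scaleC3 s u)) has_field_derivative dirderiv ?G u u) (at (exp (2 * c * complex_of_real (ln 1))))"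
    by simp
  have ex: "((\<lambda>t::real. exp (2 * b * complex_of_real (ln t))) has_vector_derivative 2 * b) (at 1)" for b
  proof -
    have "((\<lambda>t::real. 2 * b * complex_of_real (ln t)) has_vector_derivative 2 * b) (at 1)"
      by (auto intro!: derivative_eq_intros)
    from field_vector_diff_chain_at[OF this DERIV_exp]
    show ?thesis by (simp add: o_def)
  qed
  \<comment> \<open>The derivative is one-sided since \<open>shift\<close> is known only up to
    \<tau> = 1; beyond it the spiral may leave the ball.\<close>
  have "((\<lambda>t. ?G (scaleC3 (exp (2 * c * complex_of_real (ln t))) u)) has_vector_derivative 2 * c * dirderiv ?G u u) (at 1 within {0..1})"
    using field_vector_diff_chain_at[OF ex g] by (auto simp: o_def intro: has_vector_derivative_at_within)
  moreover have "((\<lambda>t. ?G (scaleC3 (exp (2 * c * complex_of_real (ln t))) u)) has_vector_derivative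
      2 * a * ?G u + ?J 1) (at 1 within {0..1})"
  proof (rule has_vector_derivative_transform_within[where d = 1])
    have "((\<lambda>t. integral {0..t} ?J) has_vector_derivative ?J 1) (at 1 within {0..1})"
      by (rule integral_has_vector_derivative[OF cJ]) simp
    from has_vector_derivative_mult[OF has_vector_derivative_at_within[OF ex] this]
    show "((\<lambda>t. exp (2 * a * complex_of_real (ln t)) * integral {0..t} ?J) has_vector_derivative 2 * a * ?G u + ?J 1) (at 1 within {0..1})"
      by (simp add: spiral_integral_def add.commute)
  qed (use shift in \<open>auto simp: dist_real_def\<close>)
  ultimately have "2 * c * dirderiv ?G u u = 2 * a * ?G u + ?J 1"
    by (intro vector_derivative_unique_within_closed_interval[of 0 1 1]) auto
  \<comment> \<open>The integrand at t = 1 is 2 F u, by the factor 2 / t, so the common factor 2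
    cancels.\<close>
  then have "2 * (c * dirderiv ?G u u) = 2 * (a * ?G u + F u)"
    by (simp add: spiral_integrand_def algebra_simps)
  then show ?thesis by (simp only: mult_cancel_left) simp
qed

section \<open>Picard iteration\<close>

definition holo3_map :: "(c3 \<Rightarrow> c3) \<Rightarrow> c3 set \<Rightarrow> bool" where
  "holo3_map G W \<longleftrightarrow> holo3 (\<lambda>p. fst (G p)) W \<and> holo3 (\<lambda>p. fst (snd (G p))) W \<and> holo3 (\<lambda>p. snd (snd (G p))) W"

definition dirderiv_map :: "(c3 \<Rightarrow> c3) \<Rightarrow> c3 \<Rightarrow> c3 \<Rightarrow> c3" where
  "dirderiv_map G p v = (dirderiv (\<lambda>p. fst (G p)) p v, dirderiv (\<lambda>p. fst (snd (G p))) p v,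
     dirderiv (\<lambda>p. snd (snd (G p))) p v)"

lemma holo3_map_derivative:
  assumes "holo3_map G W" "p \<in> W"
  shows "(G has_derivative dirderiv_map G p) (at p)"
    and "dirderiv_map G p (scaleC3 c v) = scaleC3 c (dirderiv_map G p v)"
proof -
  note h = assms(1)[unfolded holo3_map_def]
  note d = holo3_dirderiv[OF h[THEN conjunct1] assms(2)]
    holo3_dirderiv[OF h[THEN conjunct2, THEN conjunct1] assms(2)]
    holo3_dirderiv[OF h[THEN conjunct2, THEN conjunct2] assms(2)]
  have "((\<lambda>p. (fst (G p), fst (snd (G p)), snd (snd (G p)))) has_derivative
      (\<lambda>v. (dirderiv (\<lambda>p. fst (G p)) p v, dirderiv (\<lambda>p. fst (snd (G p))) p v,
     dirderiv (\<lambda>p. snd (snd (G p))) p v))) (at p)"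
    by (intro has_derivative_Pair d)
  then show "(G has_derivative dirderiv_map G p) (at p)"
    by (simp add: dirderiv_map_def[abs_def])
  show "dirderiv_map G p (scaleC3 c v) = scaleC3 c (dirderiv_map G p v)"
    using d(2,4,6) by (simp add: cplx_linear_def dirderiv_map_def scaleC3_def)
qed

lemma cplx_linear_compose:
  assumes "cplx_linear L" "linear G" "\<And>c v. G (scaleC3 c v) = scaleC3 c (G v)"
  shows "cplx_linear (\<lambda>v. L (G v))"
  using assms linear_compose[of G L] by (auto simp: cplx_linear_def o_def)

lemma holo3_compose:
  assumes "holo3 F V" "holo3_map G W" "G ` W \<subseteq> V"
  shows "holo3 (\<lambda>p. F (G p)) W"
  unfolding holo3_def
proof (intro conjI ballI exI)
  show "open W" using assms(2) by (simp add: holo3_map_def holo3_def)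
  fix p assume p: "p \<in> W"
  then have V: "G p \<in> V" using assms(3) by auto
  note G = holo3_map_derivative[OF assms(2) p] and F = holo3_dirderiv[OF assms(1) V]
  show "((\<lambda>p. F (G p)) has_derivative (\<lambda>v. dirderiv F (G p) (dirderiv_map G p v))) (at p)"
    by (rule has_derivative_compose[OF G(1) F(1)])
  show "cplx_linear (\<lambda>v. dirderiv F (G p) (dirderiv_map G p v))"
    using cplx_linear_compose[OF F(2) has_derivative_linear[OF G(1)] G(2)] .
qed

lemma holo3_linear:
  assumes "cplx_linear L" "open W" shows "holo3 L W"
  unfolding holo3_def using assms
  by (auto simp: cplx_linear_def linear_conv_bounded_linear intro!: exI[of _ L] bounded_linear_imp_has_derivative)

lemma cplx_linear_add: "cplx_linear L \<Longrightarrow> cplx_linear L' \<Longrightarrow> cplx_linear (\<lambda>v. L v + L' v)"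
  by (auto simp: cplx_linear_def linear_compose_add distrib_left)

lemma holo3_add:
  assumes "holo3 F W" "holo3 G W" shows "holo3 (\<lambda>p. F p + G p) W"
  unfolding holo3_def
proof (intro conjI ballI exI)
  show "open W" using assms by (simp add: holo3_def)
  fix p assume p: "p \<in> W"
  note F = holo3_dirderiv[OF assms(1) p] and G = holo3_dirderiv[OF assms(2) p]
  show "((\<lambda>p. F p + G p) has_derivative (\<lambda>v. dirderiv F p v + dirderiv G p v)) (at p)"
    by (intro has_derivative_add F G)
  show "cplx_linear (\<lambda>v. dirderiv F p v + dirderiv G p v)"
    by (intro cplx_linear_add F G)
qed

lemma holo3_cmult:
  assumes "holo3 F W" shows "holo3 (\<lambda>p. k * F p) W"
  unfolding holo3_def
proof (intro conjI ballI exI)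
  show "open W" using assms by (simp add: holo3_def)
  fix p assume p: "p \<in> W"
  note F = holo3_dirderiv[OF assms(1) p]
  show "((\<lambda>p. k * F p) has_derivative (\<lambda>v. k * dirderiv F p v)) (at p)"
    by (intro has_derivative_mult_right F)
  show "cplx_linear (\<lambda>v. k * dirderiv F p v)"
    using F(2) linear_compose[OF _ linear_times, of "dirderiv F p" k]
    by (auto simp: cplx_linear_def o_def)
qed

lemma cplx_linear_coord: "cplx_linear fst" "cplx_linear (\<lambda>p. fst (snd p))" "cplx_linear (\<lambda>p. snd (snd p))"
  by (auto simp: cplx_linear_def intro!: linearI)

lemma holo3_map_id_add:
  assumes "holo3_map R W" shows "holo3_map (\<lambda>p. p + R p) W"
proof -
  have "open W" using assms by (simp add: holo3_map_def holo3_def)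
  with assms show ?thesis
    by (auto simp: holo3_map_def intro!: holo3_add holo3_linear[OF cplx_linear_coord(1)]
        holo3_linear[OF cplx_linear_coord(2)] holo3_linear[OF cplx_linear_coord(3)])
qed

lemma norm_triple_le:
  assumes "norm a \<le> M" "norm b \<le> M" "norm c \<le> M"
  shows "norm ((a, b, c) :: c3) \<le> 3 * M"
  using norm_c3_le[of "(a, b, c)"] assms by simp

text \<open>In complex time \<open>c\<close> the linear part has entries \<open>c\<close>,
  \<open>c\<close>, \<open>b\<close>, and the \<open>N\<close> are the rescaled nonlinearities. The
  condition 4 r \<le> \<open>r\<^sub>0\<close> lets \<open>quadratic_Lipschitz\<close> be used on a
  ball of radius 2 |w|, where w + R w lies. The condition 48 C r \<le> 1 gives contraction by 1/2:
  three components contribute 8 C r each.\<close>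

locale spiral_picard =
  fixes c b :: complex and N1 N2 N3 :: "c3 \<Rightarrow> complex" and C r\<^sub>0 r :: real
  assumes c: "Re c = 1" and b: "Re b \<le> 1" and C: "0 < C" and r: "0 < r" "4 * r \<le> r\<^sub>0" "48 * C * r \<le> 1"
    and holo_N: "holo3 N1 (ball 0 r\<^sub>0)" "holo3 N2 (ball 0 r\<^sub>0)" "holo3 N3 (ball 0 r\<^sub>0)"
    and bound_N: "\<And>w. norm w < r\<^sub>0 \<Longrightarrow> norm (N1 w) \<le> C * (norm w)\<^sup>2"
      "\<And>w. norm w < r\<^sub>0 \<Longrightarrow> norm (N2 w) \<le> C * (norm w)\<^sup>2"
      "\<And>w. norm w < r\<^sub>0 \<Longrightarrow> norm (N3 w) \<le> C * (norm w)\<^sup>2"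
begin

text \<open>The constant 12 is 3 * 4: each component of the Picard map is bounded by C (2 |u|)^2,
  since |u + R u| \<le> 2 |u| for admissible \<open>R\<close>.\<close>

definition admissible :: "(c3 \<Rightarrow> c3) \<Rightarrow> bool" where
  "admissible R \<longleftrightarrow> holo3_map R (ball 0 r) \<and> (\<forall>u. norm u < r \<longrightarrow> norm (R u) \<le> 12 * C * (norm u)\<^sup>2)"

text \<open>By \<open>spiral_integral_equation\<close>, a fixed point satisfies c DR(u) u = (c R1 +
  N1, c R2 + N2, b R3 + N3) with the \<open>N\<close> taken at u + R u. On z = 0 this says that id +
  R carries the field c u to the rescaled system.\<close>

definition picard :: "(c3 \<Rightarrow> c3) \<Rightarrow> c3 \<Rightarrow> c3" where
  "picard R u = (spiral_integral c c (\<lambda>w. N1 (w + R w)) u,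
     spiral_integral c c (\<lambda>w. N2 (w + R w)) u, spiral_integral c b (\<lambda>w. N3 (w + R w)) u)"

lemma admissible_small:
  assumes "admissible R" "norm u < r"
  shows "norm (R u) \<le> norm u" "norm (u + R u) \<le> 2 * norm u" "norm (u + R u) < r\<^sub>0"
proof -
  have "norm (R u) \<le> (12 * C * norm u) * norm u"
    using assms by (auto simp: admissible_def power2_eq_square mult.assoc)
  also have "\<dots> \<le> 1 * norm u"
  proof (rule mult_right_mono)
    have "12 * C * norm u \<le> 12 * C * r" using C assms by (intro mult_left_mono) auto
    moreover have "12 * C * r \<le> 48 * C * r" using C r by (intro mult_right_mono) auto
    ultimately show "12 * C * norm u \<le> 1" using r by linarith
  qed auto
  finally show 1: "norm (R u) \<le> norm u" by simp
  then show 2: "norm (u + R u) \<le> 2 * norm u" using norm_triangle_ineq[of u "R u"] by linarith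
  then show "norm (u + R u) < r\<^sub>0" using assms r by linarith
qed

lemma nonlinearity_along:
  assumes R: "admissible R" and N: "holo3 N (ball 0 r\<^sub>0)" "\<And>w. norm w < r\<^sub>0 \<Longrightarrow> norm (N w) \<le> C * (norm w)\<^sup>2"
  shows "holo3 (\<lambda>w. N (w + R w)) (ball 0 r)"
    and "\<And>w. norm w < r \<Longrightarrow> norm (N (w + R w)) \<le> 4 * C * (norm w)\<^sup>2"
proof -
  show "holo3 (\<lambda>w. N (w + R w)) (ball 0 r)"
    by (rule holo3_compose[OF N(1) holo3_map_id_add])
      (use R admissible_small(3)[OF R] in \<open>auto simp: admissible_def\<close>)
  fix w :: c3 assume w: "norm w < r"
  have "norm (N (w + R w)) \<le> C * (norm (w + R w))\<^sup>2" using N(2) admissible_small(3)[OF R w] .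
  also have "\<dots> \<le> C * (2 * norm w)\<^sup>2"
    using C admissible_small(2)[OF R w] by (intro mult_left_mono power_mono) auto
  finally show "norm (N (w + R w)) \<le> 4 * C * (norm w)\<^sup>2" by (simp add: power_mult_distrib)
qed

lemma component_admissible:
  assumes "admissible R" "Re a \<le> 1" "holo3 N (ball 0 r\<^sub>0)" "\<And>w. norm w < r\<^sub>0 \<Longrightarrow> norm (N w) \<le> C * (norm w)\<^sup>2"
  shows "holo3 (spiral_integral c a (\<lambda>w. N (w + R w))) (ball 0 r)"
    and "\<And>u. norm u < r \<Longrightarrow> norm (spiral_integral c a (\<lambda>w. N (w + R w)) u) \<le> 4 * C * (norm u)\<^sup>2"
proof -
  note F = nonlinearity_along[OF assms(1,3,4)]
  show bd: "norm (spiral_integral c a (\<lambda>w. N (w + R w)) u) \<le> 4 * C * (norm u)\<^sup>2" if "norm u < r" for u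
    by (rule spiral_integral_bound[OF c assms(2) holo3_imp_continuous_on[OF F(1)] _ F(2) that]) (use C in auto)
  show "holo3 (spiral_integral c a (\<lambda>w. N (w + R w))) (ball 0 r)"
  proof (rule bounded_gholo_imp_holo3)
    show "gholo (spiral_integral c a (\<lambda>w. N (w + R w))) r"
      by (rule gholo_spiral_integral[OF c assms(2) holo3_imp_gholo[OF F(1)] _ F(2)]) (use C in auto)
    fix u :: c3 assume u: "norm u < r"
    note bd[OF u]
    also have "4 * C * (norm u)\<^sup>2 \<le> 4 * C * r\<^sup>2"
      using C u by (intro mult_left_mono power_mono) auto
    finally show "norm (spiral_integral c a (\<lambda>w. N (w + R w)) u) \<le> 4 * C * r\<^sup>2" .
  qed
qed

lemma admissible_picard:
  assumes R: "admissible R" shows "admissible (picard R)"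
  unfolding admissible_def
proof (intro conjI allI impI)
  have cc: "Re c \<le> 1" using c by simp
  note 1 = component_admissible[OF R cc holo_N(1) bound_N(1)]
    and 2 = component_admissible[OF R cc holo_N(2) bound_N(2)]
    and 3 = component_admissible[OF R b holo_N(3) bound_N(3)]
  show "holo3_map (picard R) (ball 0 r)"
    unfolding holo3_map_def picard_def using 1(1) 2(1) 3(1) by simp
  fix u :: c3 assume u: "norm u < r"
  have "norm (picard R u) \<le> 3 * (4 * C * (norm u)\<^sup>2)"
    unfolding picard_def by (intro norm_triple_le 1(2) 2(2) 3(2) u)
  then show "norm (picard R u) \<le> 12 * C * (norm u)\<^sup>2" by simp
qed

text \<open>Distances between admissible maps are measured in units of |w|^2, because the spiral
  integral accepts only integrands that vanish to second order. On the ball of radius 2 |w| the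
  Lipschitz constant of \<open>N\<close> is 8 C |w|, at most 8 C r.\<close>

lemma component_contraction:
  assumes R: "admissible R" "admissible R'" and a: "Re a \<le> 1"
    and N: "holo3 N (ball 0 r\<^sub>0)" "\<And>w. norm w < r\<^sub>0 \<Longrightarrow> norm (N w) \<le> C * (norm w)\<^sup>2"
    and d: "0 \<le> d" "\<And>w. norm w < r \<Longrightarrow> norm (R w - R' w) \<le> d * (norm w)\<^sup>2" and u: "norm u < r"
  shows "norm (spiral_integral c a (\<lambda>w. N (w + R w)) u - spiral_integral c a (\<lambda>w. N (w + R' w)) u)
     \<le> 8 * C * r * d * (norm u)\<^sup>2"
proof -
  note F = nonlinearity_along[OF R(1) N] and F' = nonlinearity_along[OF R(2) N]
  note cF = holo3_imp_continuous_on[OF F(1)] and cF' = holo3_imp_continuous_on[OF F'(1)]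
  have C4: "0 \<le> 4 * C" using C by simp
  have "norm (N (w + R w) - N (w + R' w)) \<le> 8 * C * r * d * (norm w)\<^sup>2" if w: "norm w < r" for w
  proof -
    have "norm (N (w + R w) - N (w + R' w)) \<le> 4 * C * (2 * norm w) * norm (w + R w - (w + R' w))"
      by (rule quadratic_Lipschitz[OF holo3_imp_gholo[OF N(1) order_refl] N(2)])
        (use C r w admissible_small(2)[OF R(1) w] admissible_small(2)[OF R(2) w] in auto)
    also have "\<dots> = 8 * C * norm w * norm (R w - R' w)" by simp
    also have "\<dots> \<le> 8 * C * r * (d * (norm w)\<^sup>2)"
      using C w d(2)[OF w] r by (intro mult_mono) auto
    finally show ?thesis by (simp add: mult.assoc)
  qed
  moreover have "spiral_integral c a (\<lambda>w. N (w + R w)) u - spiral_integral c a (\<lambda>w. N (w + R' w)) u =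
     spiral_integral c a (\<lambda>w. N (w + R w) - N (w + R' w)) u"
    by (rule spiral_integral_diff[OF c a C4 u cF F(2) cF' F'(2)])
  ultimately show ?thesis
    using C r d u by (auto intro!: spiral_integral_bound[OF c a, of r] continuous_intros cF cF')
qed

lemma picard_contraction:
  assumes R: "admissible R" "admissible R'"
    and d: "0 \<le> d" "\<And>w. norm w < r \<Longrightarrow> norm (R w - R' w) \<le> d * (norm w)\<^sup>2" and u: "norm u < r"
  shows "norm (picard R u - picard R' u) \<le> d / 2 * (norm u)\<^sup>2"
proof -
  have cc: "Re c \<le> 1" using c by simp
  have "norm (picard R u - picard R' u) \<le> 3 * (8 * C * r * d * (norm u)\<^sup>2)"
    unfolding picard_def diff_Pair
    by (intro norm_triple_le component_contraction[OF R cc holo_N(1) bound_N(1) d u]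
       component_contraction[OF R cc holo_N(2) bound_N(2) d u]
       component_contraction[OF R b holo_N(3) bound_N(3) d u])
  also have "\<dots> = (48 * C * r) * (d / 2 * (norm u)\<^sup>2)" by simp
  also have "\<dots> \<le> 1 * (d / 2 * (norm u)\<^sup>2)"
    using r d by (intro mult_right_mono) auto
  finally show ?thesis by simp
qed

definition iter :: "nat \<Rightarrow> c3 \<Rightarrow> c3" where
  "iter n = (picard ^^ n) (\<lambda>_. 0)"

lemma iter_simps: "iter 0 u = 0" "iter (Suc n) u = picard (iter n) u"
  by (simp_all add: iter_def)

lemma admissible_iter: "admissible (iter n)"
proof (induction n)
  case 0
  have "holo3 (\<lambda>_. 0) (ball 0 r)"
    by (rule holo3_linear) (auto simp: cplx_linear_def intro!: linearI)
  then show ?case using C by (simp add: iter_def admissible_def holo3_map_def)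
next
  case (Suc n)
  then show ?case using admissible_picard by (simp add: iter_def)
qed

lemma iter_step: "norm u < r \<Longrightarrow> norm (iter (Suc n) u - iter n u) \<le> 12 * C * (1/2)^n * (norm u)\<^sup>2"
proof (induction n arbitrary: u)
  case 0
  then show ?case using admissible_iter[of 1] by (simp add: iter_simps admissible_def)
next
  case (Suc n)
  have "norm (picard (iter (Suc n)) u - picard (iter n) u) \<le> (12 * C * (1/2)^n) / 2 * (norm u)\<^sup>2"
    by (rule picard_contraction[OF admissible_iter admissible_iter]) (use Suc C in auto)
  then show ?case by (simp add: iter_simps)
qed

text \<open>A geometric sum with first term 12 C and ratio 1/2. The exact factor 1 - (1/2)^k is kept
  so that the induction on \<open>k\<close> closes.\<close>

lemma iter_diff:
  assumes "norm u < r"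
  shows "norm (iter (n + k) u - iter n u) \<le> 24 * C * (1/2)^n * (1 - (1/2)^k) * (norm u)\<^sup>2"
proof (induction k)
  case (Suc k)
  have "norm (iter (n + Suc k) u - iter n u) \<le>
     norm (iter (Suc (n + k)) u - iter (n + k) u) + norm (iter (n + k) u - iter n u)"
    using norm_triangle_ineq[of "iter (Suc (n + k)) u - iter (n + k) u" "iter (n + k) u - iter n u"] by simp
  also have "\<dots> \<le> 12 * C * (1/2)^(n + k) * (norm u)\<^sup>2 + 24 * C * (1/2)^n * (1 - (1/2)^k) * (norm u)\<^sup>2"
    by (intro add_mono iter_step assms Suc)
  also have "\<dots> = 24 * C * (1/2)^n * (1 - (1/2)^Suc k) * (norm u)\<^sup>2"
    by (simp add: power_add algebra_simps)
  finally show ?case .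
qed simp

definition fixmap :: "c3 \<Rightarrow> c3" where
  "fixmap u = lim (\<lambda>n. iter n u)"

lemma iter_diff': "norm u < r \<Longrightarrow> n \<le> m \<Longrightarrow> norm (iter m u - iter n u) \<le> 24 * C * (1/2)^n * (norm u)\<^sup>2"
proof -
  assume u: "norm u < r" and "n \<le> m"
  then obtain k where k: "m = n + k" using le_Suc_ex by blast
  have "24 * C * (1/2)^n * (1 - (1/2)^k) * (norm u)\<^sup>2 \<le> 24 * C * (1/2)^n * 1 * (norm u)\<^sup>2"
    using C by (intro mult_right_mono mult_left_mono) auto
  then show ?thesis using iter_diff[OF u, of n k] k by simp
qed

lemma geometric_tendsto_0: "(\<lambda>n. K * (1/2)^n * M) \<longlonglongrightarrow> (0::real)"
  by (intro tendsto_mult_left_zero tendsto_mult_right_zero LIMSEQ_power_zero) simp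

lemma iter_tendsto: assumes u: "norm u < r" shows "(\<lambda>n. iter n u) \<longlonglongrightarrow> fixmap u"
proof -
  have "Cauchy (\<lambda>n. iter n u)"
  proof (rule metric_CauchyI)
    fix e :: real assume "e > 0"
    then obtain n where n: "24 * C * (1/2)^n * (norm u)\<^sup>2 < e / 2"
      using order_tendstoD(2)[OF geometric_tendsto_0[of "24 * C" "(norm u)\<^sup>2"], of "e / 2"]
      by (auto simp: eventually_sequentially)
    have "dist (iter m u) (iter m' u) < e" if "m \<ge> n" "m' \<ge> n" for m m'
    proof -
      have "dist (iter m u) (iter n u) < e / 2" "dist (iter m' u) (iter n u) < e / 2"
        using iter_diff'[OF u that(1)] iter_diff'[OF u that(2)] n unfolding dist_norm by linarith+
      then show ?thesis by (rule dist_triangle_half_l)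
    qed
    then show "\<exists>M. \<forall>m\<ge>M. \<forall>n\<ge>M. dist (iter m u) (iter n u) < e" by blast
  qed
  then show ?thesis unfolding fixmap_def
    by (simp add: Cauchy_convergent_iff convergent_LIMSEQ_iff)
qed

lemma fixmap_diff:
  assumes u: "norm u < r" shows "norm (fixmap u - iter n u) \<le> 24 * C * (1/2)^n * (norm u)\<^sup>2"
proof (rule tendsto_upperbound)
  show "(\<lambda>m. norm (iter m u - iter n u)) \<longlonglongrightarrow> norm (fixmap u - iter n u)"
    by (intro tendsto_intros iter_tendsto u)
  show "\<forall>\<^sub>F m in sequentially. norm (iter m u - iter n u) \<le> 24 * C * (1/2)^n * (norm u)\<^sup>2"
    using eventually_ge_at_top[of n] by eventually_elim (rule iter_diff'[OF u])
qed simp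

lemma fixmap_bound: assumes u: "norm u < r" shows "norm (fixmap u) \<le> 12 * C * (norm u)\<^sup>2"
proof (rule tendsto_upperbound)
  show "(\<lambda>m. norm (iter m u)) \<longlonglongrightarrow> norm (fixmap u)"
    by (intro tendsto_intros iter_tendsto u)
  show "\<forall>\<^sub>F m in sequentially. norm (iter m u) \<le> 12 * C * (norm u)\<^sup>2"
    using admissible_iter u by (auto simp: admissible_def)
qed simp

lemma uniform_limit_iter: "uniform_limit (ball 0 r) iter fixmap sequentially"
proof (rule uniform_limitI)
  fix e :: real assume e: "e > 0"
  have "\<forall>\<^sub>F n in sequentially. 24 * C * (1/2)^n * r\<^sup>2 < e"
    using order_tendstoD(2)[OF geometric_tendsto_0 e] .
  then show "\<forall>\<^sub>F n in sequentially. \<forall>u\<in>ball 0 r. dist (iter n u) (fixmap u) < e"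
  proof eventually_elim
    case (elim n)
    show ?case
    proof
      fix u :: c3 assume "u \<in> ball 0 r"
      then have u: "norm u < r" by simp
      have "dist (iter n u) (fixmap u) \<le> 24 * C * (1/2)^n * (norm u)\<^sup>2"
        using fixmap_diff[OF u, of n] by (simp add: dist_norm norm_minus_commute)
      also have "\<dots> \<le> 24 * C * (1/2)^n * r\<^sup>2"
        using C u by (intro mult_left_mono power_mono) auto
      finally show "dist (iter n u) (fixmap u) < e" using elim by simp
    qed
  qed
qed

text \<open>Weierstrass's theorem on each complex line, followed by the bound that leads back to
  \<open>holo3\<close>. The projection \<pi> stands for one of the three coordinates.\<close>

lemma component_limit:
  assumes "bounded_linear \<pi>" "\<And>n. holo3 (\<lambda>u. \<pi> (iter n u)) (ball 0 r)" "\<And>v. norm (\<pi> v :: complex) \<le> norm v"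
  shows "holo3 (\<lambda>u. \<pi> (fixmap u)) (ball 0 r)"
proof (rule bounded_gholo_imp_holo3)
  have ul: "uniform_limit (ball 0 r) (\<lambda>n u. \<pi> (iter n u)) (\<lambda>u. \<pi> (fixmap u)) sequentially"
    by (rule bounded_linear.uniform_limit[OF assms(1) uniform_limit_iter])
  show "gholo (\<lambda>u. \<pi> (fixmap u)) r"
    unfolding gholo_def
  proof (intro allI)
    fix p v :: c3
    let ?S = "{s. norm (p + scaleC3 s v) < r}"
    have ul': "uniform_limit ?S (\<lambda>n s. \<pi> (iter n (p + scaleC3 s v))) (\<lambda>s. \<pi> (fixmap (p + scaleC3 s v))) sequentially"
      by (rule uniform_limit_compose'[OF ul]) auto
    show "(\<lambda>s. \<pi> (fixmap (p + scaleC3 s v))) holomorphic_on ?S"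
    proof (rule holomorphic_uniform_sequence[OF open_line_ball])
      fix n show "(\<lambda>s. \<pi> (iter n (p + scaleC3 s v))) holomorphic_on ?S"
        using holo3_imp_gholo[OF assms(2) order_refl] by (auto simp: gholo_def)
    next
      fix s assume "s \<in> ?S"
      then obtain d where "d > 0" "cball s d \<subseteq> ?S"
        using open_contains_cball open_line_ball by blast
      then show "\<exists>d>0. cball s d \<subseteq> ?S \<and> uniform_limit (cball s d) (\<lambda>n s. \<pi> (iter n (p + scaleC3 s v)))
          (\<lambda>s. \<pi> (fixmap (p + scaleC3 s v))) sequentially"
        using uniform_limit_on_subset[OF ul'] by blast
    qed
  qed
  fix u :: c3 assume u: "norm u < r"
  have "norm (\<pi> (fixmap u)) \<le> 12 * C * (norm u)\<^sup>2" using assms(3)[of "fixmap u"] fixmap_bound[OF u] by linarith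
  also have "\<dots> \<le> 12 * C * r\<^sup>2" using C u by (intro mult_left_mono power_mono) auto
  finally show "norm (\<pi> (fixmap u)) \<le> 12 * C * r\<^sup>2" .
qed

lemma admissible_fixmap: "admissible fixmap"
proof -
  have "holo3_map (iter n) (ball 0 r)" for n using admissible_iter by (simp add: admissible_def)
  then have "holo3_map fixmap (ball 0 r)"
    unfolding holo3_map_def
    by (intro conjI component_limit)
      (auto intro!: norm_c3_ge bounded_linear_fst bounded_linear_snd
        bounded_linear_compose[OF bounded_linear_fst bounded_linear_snd]
        bounded_linear_compose[OF bounded_linear_snd bounded_linear_snd])
  then show ?thesis using fixmap_bound by (simp add: admissible_def)
qed

text \<open>Both \<open>picard fixmap\<close> and \<open>fixmap\<close> are within 12 C (1/2)^n
  |u|^2 of \<open>iter (Suc n)\<close>: the first by contraction, the second by the rate of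
  convergence.\<close>

lemma picard_fixmap:
  assumes u: "norm u < r" shows "picard fixmap u = fixmap u"
proof -
  have "norm (picard fixmap u - fixmap u) \<le> 24 * C * (1/2)^n * (norm u)\<^sup>2" for n
  proof -
    have "norm (picard fixmap u - picard (iter n) u) \<le> (24 * C * (1/2)^n) / 2 * (norm u)\<^sup>2"
      by (rule picard_contraction[OF admissible_fixmap admissible_iter]) (use C fixmap_diff u in auto)
    moreover have "norm (fixmap u - picard (iter n) u) \<le> 24 * C * (1/2)^Suc n * (norm u)\<^sup>2"
      using fixmap_diff[OF u, of "Suc n"] by (simp add: iter_simps)
    ultimately show ?thesis
      using norm_triangle_ineq4[of "picard fixmap u - picard (iter n) u" "fixmap u - picard (iter n) u"]
      by simp
  qed
  then have "norm (picard fixmap u - fixmap u) \<le> 0"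
    by (intro tendsto_lowerbound[OF geometric_tendsto_0[of "24 * C" "(norm u)\<^sup>2"]]) auto
  then show ?thesis by simp
qed

text \<open>It agrees with \<open>fixmap\<close> on the ball only. Written as a Picard image, its
  components are spiral integrals as functions, so \<open>spiral_integral_equation\<close> applies
  to their \<open>dirderiv\<close> by unfolding.\<close>

definition remainder :: "c3 \<Rightarrow> c3" where
  "remainder = picard fixmap"

lemma remainder_props:
  "holo3_map remainder (ball 0 r)"
  "norm u < r \<Longrightarrow> norm (remainder u) \<le> 12 * C * (norm u)\<^sup>2"
  using admissible_picard[OF admissible_fixmap] by (auto simp: remainder_def admissible_def)

lemma remainder_equation:
  assumes u: "norm u < r"
  shows "c * dirderiv (\<lambda>u. fst (remainder u)) u u = c * fst (remainder u) + N1 (u + remainder u)"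
    and "c * dirderiv (\<lambda>u. fst (snd (remainder u))) u u = c * fst (snd (remainder u)) + N2 (u + remainder u)"
    and "c * dirderiv (\<lambda>u. snd (snd (remainder u))) u u = b * snd (snd (remainder u)) + N3 (u + remainder u)"
proof -
  have cc: "Re c \<le> 1" using c by simp
  have C4: "0 \<le> 4 * C" using C by simp
  have eq: "c * dirderiv (spiral_integral c a (\<lambda>w. N (w + fixmap w))) u u =
     a * spiral_integral c a (\<lambda>w. N (w + fixmap w)) u + N (u + remainder u)"
    if "Re a \<le> 1" "holo3 N (ball 0 r\<^sub>0)" "\<And>w. norm w < r\<^sub>0 \<Longrightarrow> norm (N w) \<le> C * (norm w)\<^sup>2" for a N
  proof -
    note F = nonlinearity_along[OF admissible_fixmap that(2,3)]
    have "c * dirderiv (spiral_integral c a (\<lambda>w. N (w + fixmap w))) u u =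
     a * spiral_integral c a (\<lambda>w. N (w + fixmap w)) u + N (u + fixmap u)"
      by (rule spiral_integral_equation[OF c that(1) holo3_imp_gholo[OF F(1) order_refl] C4 F(2) u])
    then show ?thesis using picard_fixmap[OF u] by (simp add: remainder_def)
  qed
  show "c * dirderiv (\<lambda>u. fst (remainder u)) u u = c * fst (remainder u) + N1 (u + remainder u)"
    "c * dirderiv (\<lambda>u. fst (snd (remainder u))) u u = c * fst (snd (remainder u)) + N2 (u + remainder u)"
    "c * dirderiv (\<lambda>u. snd (snd (remainder u))) u u = b * snd (snd (remainder u)) + N3 (u + remainder u)"
    using eq[OF cc holo_N(1) bound_N(1)] eq[OF cc holo_N(2) bound_N(2)] eq[OF b holo_N(3) bound_N(3)]
    unfolding remainder_def picard_def by simp_all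
qed

end

section \<open>Maps close to the identity and uniqueness of trajectories\<close>

lemma quadratic_dirderiv:
  assumes "gholo F r" and C: "\<And>w. norm w < r \<Longrightarrow> norm (F w) \<le> C * (norm w)\<^sup>2"
    and "0 \<le> C" "0 < a" "2 * a < r" "norm p \<le> a"
  shows "norm (dirderiv F p v) \<le> 4 * C * a * norm v"
proof -
  have "norm (dirderiv F p v) \<le> (C * (2 * a)\<^sup>2) / a * norm v"
  proof (rule dirderiv_bound[OF assms(1,4,6)])
    fix w :: c3 assume "norm w \<le> a + a"
    then show "norm (F w) \<le> C * (2 * a)\<^sup>2"
      using C[of w] assms(3,5) mult_left_mono[OF power_mono[of "norm w" "2 * a" 2], of C] by auto
  qed (use assms in auto)
  thus ?thesis using assms(4) by (simp add: power2_eq_square)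
qed

text \<open>The condition 24 K a \<le> 1 makes \<open>R\<close> Lipschitz with constant 1/2 on the
  ball of radius \<open>a\<close>: each of the three components has constant 4 K a by
  \<open>quadratic_Lipschitz\<close>.\<close>

locale near_identity =
  fixes R :: "c3 \<Rightarrow> c3" and K r a :: real
  assumes holo_R: "holo3_map R (ball 0 r)"
    and bound_R: "\<And>u. norm u < r \<Longrightarrow> norm (R u) \<le> K * (norm u)\<^sup>2"
    and K: "0 < K" and a: "0 < a" "2 * a < r" "24 * K * a \<le> 1"
begin

lemma component_bounds:
  "norm w < r \<Longrightarrow> norm (fst (R w)) \<le> K * (norm w)\<^sup>2"
  "norm w < r \<Longrightarrow> norm (fst (snd (R w))) \<le> K * (norm w)\<^sup>2"
  "norm w < r \<Longrightarrow> norm (snd (snd (R w))) \<le> K * (norm w)\<^sup>2"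
  using bound_R[of w] norm_c3_ge[of "R w"] by linarith+

lemma component_gholo:
  "gholo (\<lambda>w. fst (R w)) r" "gholo (\<lambda>w. fst (snd (R w))) r" "gholo (\<lambda>w. snd (snd (R w))) r"
  using holo_R by (auto simp: holo3_map_def intro!: holo3_imp_gholo)

lemma half: "3 * (4 * K * a * x) \<le> x / 2" if "0 \<le> x" for x
  using mult_right_mono[OF a(3) that] by (simp add: algebra_simps)

lemma R_Lipschitz:
  assumes "norm p \<le> a" "norm q \<le> a"
  shows "norm (R q - R p) \<le> norm (q - p) / 2"
proof -
  have "norm (R q - R p) \<le> norm (fst (R q - R p)) + norm (fst (snd (R q - R p))) + norm (snd (snd (R q - R p)))"
    by (rule norm_c3_le)
  also have "\<dots> \<le> 4 * K * a * norm (q - p) + 4 * K * a * norm (q - p) + 4 * K * a * norm (q - p)"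
    unfolding fst_diff snd_diff using K a assms
    by (intro add_mono quadratic_Lipschitz[OF component_gholo(1) component_bounds(1)]
      quadratic_Lipschitz[OF component_gholo(2) component_bounds(2)]
      quadratic_Lipschitz[OF component_gholo(3) component_bounds(3)]) auto
  also have "\<dots> \<le> norm (q - p) / 2" using half[of "norm (q - p)"] by simp
  finally show ?thesis .
qed

lemma R_dirderiv:
  assumes "norm p \<le> a"
  shows "norm (dirderiv_map R p v) \<le> norm v / 2"
proof -
  have "norm (dirderiv_map R p v) \<le> 3 * (4 * K * a * norm v)"
    unfolding dirderiv_map_def using K a assms
    by (intro norm_triple_le quadratic_dirderiv[OF component_gholo(1) component_bounds(1)]
      quadratic_dirderiv[OF component_gholo(2) component_bounds(2)]
      quadratic_dirderiv[OF component_gholo(3) component_bounds(3)]) auto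
  also have "\<dots> \<le> norm v / 2" by (rule half) simp
  finally show ?thesis .
qed

definition \<Theta> :: "c3 \<Rightarrow> c3" where
  "\<Theta> u = u + R u"

lemma holo_\<Theta>: "holo3_map \<Theta> (ball 0 r)"
  unfolding \<Theta>_def[abs_def] by (rule holo3_map_id_add[OF holo_R])

lemma dirderiv_\<Theta>:
  assumes "norm p < r" shows "dirderiv_map \<Theta> p v = v + dirderiv_map R p v"
proof -
  have p: "p \<in> ball 0 r" using assms by simp
  have "(\<Theta> has_derivative (\<lambda>v. v + dirderiv_map R p v)) (at p)"
    unfolding \<Theta>_def[abs_def] by (intro has_derivative_add has_derivative_ident holo3_map_derivative(1)[OF holo_R p])
  from has_derivative_unique[OF holo3_map_derivative(1)[OF holo_\<Theta> p] this]
  show ?thesis by metis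
qed

lemma R_0: "R 0 = 0" "\<Theta> 0 = 0"
  using bound_R[of 0] a by (auto simp: \<Theta>_def)

lemma R_small: assumes "norm u \<le> a" shows "norm (R u) \<le> norm u / 2"
  using R_Lipschitz[of 0 u] assms a R_0 by simp

lemma \<Theta>_small: "norm u \<le> a \<Longrightarrow> norm (\<Theta> u) \<le> 2 * norm u"
  unfolding \<Theta>_def
  by (rule order_trans[OF norm_triangle_ineq]) (use R_small[of u] norm_ge_zero[of u] in linarith)

lemma \<Theta>_expand:
  assumes "norm p \<le> a" "norm q \<le> a"
  shows "norm (q - p) \<le> 2 * norm (\<Theta> q - \<Theta> p)"
proof -
  have "q - p = (\<Theta> q - \<Theta> p) - (R q - R p)" by (simp add: \<Theta>_def)
  then have "norm (q - p) \<le> norm (\<Theta> q - \<Theta> p) + norm (R q - R p)" by (metis norm_triangle_ineq4)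
  then show ?thesis using R_Lipschitz[OF assms] by simp
qed

lemma inj_\<Theta>: "inj_on \<Theta> (ball 0 a)"
proof (rule inj_onI)
  fix p q assume "p \<in> ball 0 a" "q \<in> ball 0 a" "\<Theta> p = \<Theta> q"
  then show "p = q" using \<Theta>_expand[of p q] by simp
qed

text \<open>Since \<open>R\<close> is of second order, its derivative at 0 is bounded by a multiple
  of every small radius e; e tends to 0.\<close>

lemma dirderiv_\<Theta>_0: "dirderiv_map \<Theta> 0 v = v"
proof -
  have "norm (dirderiv_map R 0 v) \<le> 12 * K * e * norm v" if "e \<in> {0<..<a}" for e
  proof -
    have "norm (dirderiv_map R 0 v) \<le> 3 * (4 * K * e * norm v)"
      unfolding dirderiv_map_def using K a that
      by (intro norm_triple_le quadratic_dirderiv[OF component_gholo(1) component_bounds(1)]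
        quadratic_dirderiv[OF component_gholo(2) component_bounds(2)]
        quadratic_dirderiv[OF component_gholo(3) component_bounds(3)]) auto
    then show ?thesis by simp
  qed
  then have ev: "\<forall>\<^sub>F e in at_right 0. norm (dirderiv_map R 0 v) \<le> 12 * K * e * norm v"
    using eventually_at_right_less[of 0] a(1)
    by (auto simp: eventually_at_right_field intro: exI[of _ a])
  have "((\<lambda>e. 12 * K * e * norm v) \<longlongrightarrow> 0) (at_right 0)" by (auto intro!: tendsto_eq_intros)
  from tendsto_lowerbound[OF this ev] have "dirderiv_map R 0 v = 0" by simp
  then show ?thesis using dirderiv_\<Theta>[of 0 v] a by simp
qed

text \<open>Invariance of domain gives openness from continuity and injectivity alone, before
  anything is known about the inverse.\<close>

lemma open_image: "open (\<Theta> ` ball 0 a)"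
proof (rule invariance_of_domain[OF _ open_ball inj_\<Theta>])
  have "ball 0 a \<subseteq> ball (0::c3) r" using a by auto
  then show "continuous_on (ball 0 a) \<Theta>"
    by (meson continuous_at_imp_continuous_on has_derivative_continuous holo3_map_derivative(1) holo_\<Theta> subsetD)
qed

definition \<Phi> :: "c3 \<Rightarrow> complex" where
  "\<Phi> p = snd (snd (inv_into (ball 0 a) \<Theta> p))"

lemma \<Phi>_\<Theta>: "norm u < a \<Longrightarrow> \<Phi> (\<Theta> u) = snd (snd u)"
  unfolding \<Phi>_def using inv_into_f_f[OF inj_\<Theta>, of u] by simp

text \<open>The derivative of \<Theta> is the identity plus a map of norm at most 1/2, hence
  invertible. The inverse of \<Theta> is Lipschitz with constant 2 by
  \<open>\<Theta>_expand\<close>, hence continuous, hence differentiable. Complex linearity passes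
  from a linear map to its inverse.\<close>

lemma \<Phi>_derivative:
  assumes u: "norm u < a"
  obtains L where "(\<Phi> has_derivative L) (at (\<Theta> u))" "cplx_linear L"
    "\<And>v. L (dirderiv_map \<Theta> u v) = snd (snd v)"
proof -
  let ?g = "inv_into (ball 0 a) \<Theta>" and ?D = "dirderiv_map \<Theta> u"
  have ur: "u \<in> ball 0 r" "norm u < r" using u a by auto
  note D = holo3_map_derivative[OF holo_\<Theta> ur(1)]
  have lin: "linear ?D" using D(1) by (rule has_derivative_linear)
  have "inj ?D"
  proof (rule linear_injective_0[OF lin, THEN iffD2], intro allI impI)
    fix v assume "?D v = 0"
    then have "v = - dirderiv_map R u v" using dirderiv_\<Theta>[OF ur(2), of v] by (simp add: add_eq_0_iff2)
    then have "norm v \<le> norm v / 2" using R_dirderiv[of u v] u by (metis less_imp_le norm_minus_cancel)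
    then show "v = 0" by simp
  qed
  then obtain G where G: "linear G" "\<And>v. G (?D v) = v" "\<And>v. ?D (G v) = v"
    using linear_injective_isomorphism[OF lin] by metis
  have Gc: "G (scaleC3 c w) = scaleC3 c (G w)" for c w
    using D(2)[of c "G w"] G by metis
  have inv: "?g (\<Theta> p) = p" if "norm p < a" for p using inv_into_f_f[OF inj_\<Theta>, of p] that by simp
  have "continuous_on (\<Theta> ` ball 0 a) ?g"
  proof (rule lipschitz_on_continuous_on, rule lipschitz_onI[of _ _ 2])
    fix x y assume "x \<in> \<Theta> ` ball 0 a" "y \<in> \<Theta> ` ball 0 a"
    then obtain p q where pq: "x = \<Theta> p" "y = \<Theta> q" "norm p < a" "norm q < a" by auto
    show "dist (?g x) (?g y) \<le> 2 * dist x y"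
      unfolding pq(1,2) inv[OF pq(3)] inv[OF pq(4)] dist_norm using \<Theta>_expand[of q p] pq by simp
  qed simp
  then have cont: "continuous (at (\<Theta> u)) ?g"
    using open_image u by (simp add: continuous_on_eq_continuous_at)
  have "(?g has_derivative G) (at (\<Theta> u))"
  proof (rule has_derivative_inverse_basic[OF _ _ _ cont open_image])
    show "(\<Theta> has_derivative ?D) (at (?g (\<Theta> u)))" using D(1) inv[OF u] by simp
    show "bounded_linear G" using G(1) by (simp add: linear_conv_bounded_linear)
  qed (use G u in \<open>auto simp: o_def fun_eq_iff f_inv_into_f\<close>)
  then have "(\<Phi> has_derivative (\<lambda>v. snd (snd (G v)))) (at (\<Theta> u))"
    unfolding \<Phi>_def[abs_def] by (intro has_derivative_snd)
  moreover have "cplx_linear (\<lambda>v. snd (snd (G v)))"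
    by (rule cplx_linear_compose[OF cplx_linear_coord(3) G(1) Gc])
  ultimately show ?thesis using that G(2) by metis
qed

lemma holo_\<Phi>: "holo3 \<Phi> (\<Theta> ` ball 0 a)"
  unfolding holo3_def using open_image by (auto elim!: \<Phi>_derivative)

lemma frechet_\<Phi>:
  assumes "norm u < a"
  shows "frechet_derivative \<Phi> (at (\<Theta> u)) (dirderiv_map \<Theta> u v) = snd (snd v)"
  using \<Phi>_derivative[OF assms] frechet_derivative_at by metis

end

text \<open>Only \<delta> is assumed to stay in the ball where \<open>X\<close> is Lipschitz. Near a
  time of agreement \<gamma> is in it too, by continuity, so the set of agreement is open as well as
  closed.\<close>

lemma ode_unique:
  fixes X :: "'a::real_normed_vector \<Rightarrow> 'a"
  assumes L: "0 \<le> L" "\<And>p q. norm p < \<rho> \<Longrightarrow> norm q < \<rho> \<Longrightarrow> norm (X p - X q) \<le> L * norm (p - q)"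
    and \<gamma>: "\<And>t. (\<gamma> has_vector_derivative X (\<gamma> t)) (at t)"
    and \<delta>: "\<And>t. (\<delta> has_vector_derivative X (\<delta> t)) (at t)" "\<And>t. norm (\<delta> t) < \<rho>"
    and eq0: "\<gamma> 0 = \<delta> 0"
  shows "\<gamma> t = \<delta> t"
proof -
  have cont: "continuous_on UNIV \<gamma>" "continuous_on UNIV \<delta>"
    using \<gamma> \<delta> by (auto intro!: continuous_at_imp_continuous_on has_vector_derivative_continuous)
  define A where "A = {t. \<gamma> t = \<delta> t}"
  have "closed A" unfolding A_def by (intro closed_Collect_eq cont)
  moreover have "open A"
    unfolding open_contains_ball
  proof
    fix t0 assume "t0 \<in> A"
    then have t0: "\<gamma> t0 = \<delta> t0" by (simp add: A_def)
    have "open {t. norm (\<gamma> t) < \<rho>}" by (intro open_Collect_less continuous_intros cont)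
    moreover have "t0 \<in> {t. norm (\<gamma> t) < \<rho>}" using t0 \<delta>(2) by simp
    ultimately obtain e0 where e0: "e0 > 0" "ball t0 e0 \<subseteq> {t. norm (\<gamma> t) < \<rho>}"
      using open_contains_ball by blast
    \<comment> \<open>e0 / 2 keeps the closed interval inside the open one, and L + 1 makes L e
      \<le> 1/2 also when L = 0. The maximum of |\<gamma> - \<delta>| on the interval is then at
      most half of itself.\<close>
    define e where "e = min (e0 / 2) (1 / (2 * (L + 1)))"
    have e: "e > 0" "e < e0" "L * e \<le> 1 / 2"
    proof -
      show "e > 0" "e < e0" using e0 L by (auto simp: e_def)
      have "L * e \<le> (L + 1) * (1 / (2 * (L + 1)))" using L e0 by (intro mult_mono) (auto simp: e_def)
      also have "\<dots> = 1 / 2" using L(1) by (simp add: field_simps)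
      finally show "L * e \<le> 1 / 2" .
    qed
    define d where "d = (\<lambda>t. \<gamma> t - \<delta> t)"
    have "continuous_on (cball t0 e) (\<lambda>t. norm (d t))"
      unfolding d_def by (intro continuous_intros continuous_on_subset[OF cont(1)] continuous_on_subset[OF cont(2)]) auto
    then obtain s where s: "s \<in> cball t0 e" "\<And>t. t \<in> cball t0 e \<Longrightarrow> norm (d t) \<le> norm (d s)"
      using continuous_attains_sup[of "cball t0 e" "\<lambda>t. norm (d t)"] e(1) by fastforce
    have "norm (d s - d t0) \<le> (L * norm (d s)) * norm (s - t0)"
    proof (rule differentiable_bound[of "cball t0 e" d "\<lambda>t h. h *\<^sub>R (X (\<gamma> t) - X (\<delta> t))"])
      fix t assume t: "t \<in> cball t0 e"
      show "(d has_derivative (\<lambda>h. h *\<^sub>R (X (\<gamma> t) - X (\<delta> t)))) (at t within cball t0 e)"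
        using has_vector_derivative_diff[OF \<gamma> \<delta>(1), of t]
        unfolding d_def has_vector_derivative_def by (rule has_derivative_at_withinI)
      have "norm (\<gamma> t) < \<rho>" using e0(2) t e(2) by (auto simp: subset_iff)
      then have "norm (X (\<gamma> t) - X (\<delta> t)) \<le> L * norm (d t)"
        using L(2) \<delta>(2) by (simp add: d_def)
      also have "\<dots> \<le> L * norm (d s)" using s(2)[OF t] L(1) by (rule mult_left_mono)
      finally have "norm (X (\<gamma> t) - X (\<delta> t)) \<le> L * norm (d s)" .
      then show "onorm (\<lambda>h. h *\<^sub>R (X (\<gamma> t) - X (\<delta> t))) \<le> L * norm (d s)"
        by (intro onorm_le) (simp add: mult.commute mult_left_mono)
    qed (use s e in auto)
    also have "\<dots> \<le> L * norm (d s) * e"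
      using s(1) L(1) by (intro mult_left_mono) (auto simp: dist_real_def)
    also have "\<dots> = (L * e) * norm (d s)" by simp
    also have "\<dots> \<le> 1 / 2 * norm (d s)" using e(3) by (rule mult_right_mono) simp
    finally have "norm (d s) \<le> 0" using t0 by (simp add: d_def)
    then have "ball t0 e \<subseteq> A" using s(2) by (force simp: A_def d_def)
    then show "\<exists>e>0. ball t0 e \<subseteq> A" using e(1) by blast
  qed
  ultimately have "A = {} \<or> A = UNIV"
    using clopen by blast
  then show ?thesis using eq0 by (auto simp: A_def)
qed

section \<open>Uniqueness of the center manifold\<close>

lemma holomorphic_zero_of_singular_ode:
  assumes hol: "w holomorphic_on ball 0 R" and R: "0 < R" and w0: "w 0 = 0"
    and ineq: "\<And>s. s \<in> ball 0 R \<Longrightarrow> norm (\<i> * of_real \<omega> * s * deriv w s - lam * w s) \<le> \<epsilon> * norm (w s)"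
    and \<epsilon>: "\<epsilon> < \<bar>Re lam\<bar>"
    and s: "s \<in> ball 0 R"
  shows "w s = 0"
proof (cases "w constant_on ball 0 R")
  case True
  then show ?thesis using w0 s R by (force simp: constant_on_def)
next
  case False
  have "(0::complex) \<in> ball 0 R" using R by simp
  then obtain g r n where g: "0 < n" "0 < r" "ball 0 r \<subseteq> ball (0::complex) R" "g holomorphic_on ball 0 r"
    "\<And>s. s \<in> ball 0 r \<Longrightarrow> w s = (s - 0) ^ n * g s" "\<And>s. s \<in> ball 0 r \<Longrightarrow> g s \<noteq> 0"
    by (rule holomorphic_factor_zero_nonconstant[OF hol open_ball connected_ball _ w0 False]) blast
  have dg: "(g has_field_derivative deriv g s) (at s)" if "s \<in> ball 0 r" for s
    using g(4) that by (intro holomorphic_derivI[of _ "ball 0 r"]) auto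
  have est: "norm (\<i> * of_real \<omega> * (of_nat n * g s + s * deriv g s) - lam * g s) \<le> \<epsilon> * norm (g s)"
    if s: "s \<in> ball 0 r" "s \<noteq> 0" for s
  proof -
    have "((\<lambda>s. s ^ n * g s) has_field_derivative (of_nat n * s ^ (n - 1) * g s + s ^ n * deriv g s)) (at s)"
      by (auto intro!: derivative_eq_intros dg s)
    then have "(w has_field_derivative (of_nat n * s ^ (n - 1) * g s + s ^ n * deriv g s)) (at s)"
      by (rule has_field_derivative_transform_within_open[OF _ open_ball s(1)]) (use g(5) in auto)
    then have "s * deriv w s = s * (of_nat n * s ^ (n - 1) * g s + s ^ n * deriv g s)"
      by (simp add: DERIV_imp_deriv)
    also have "\<dots> = s ^ n * (of_nat n * g s + s * deriv g s)"
      using g(1) by (cases n) (auto simp: algebra_simps)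
    finally have d: "s * deriv w s = s ^ n * (of_nat n * g s + s * deriv g s)" .
    have "s \<in> ball 0 R" using g(3) s by auto
    from ineq[OF this]
    have "norm (\<i> * of_real \<omega> * (s * deriv w s) - lam * w s) \<le> \<epsilon> * norm (w s)" by (simp add: mult.assoc)
    also have "\<i> * of_real \<omega> * (s * deriv w s) - lam * w s =
       s ^ n * (\<i> * of_real \<omega> * (of_nat n * g s + s * deriv g s) - lam * g s)"
      unfolding d using g(5)[OF s(1)] by (simp add: algebra_simps)
    also have "\<epsilon> * norm (w s) = norm (s ^ n) * (\<epsilon> * norm (g s))"
      using g(5)[OF s(1)] by (simp add: norm_mult)
    finally show ?thesis using s(2) by (simp add: norm_mult)
  qed
  have r0: "0 \<in> ball (0::complex) r" using g(2) by simp
  have "isCont g 0" "isCont (deriv g) 0"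
    using g(4) holomorphic_deriv[OF g(4)] r0
    by (auto dest!: holomorphic_on_imp_continuous_on simp: continuous_on_eq_continuous_at)
  then have lims: "(g \<longlongrightarrow> g 0) (at 0)" "(deriv g \<longlongrightarrow> deriv g 0) (at 0)" by (auto simp: isCont_def)
  \<comment> \<open>Division by s^n is possible only for s \<noteq> 0, so the value at 0 is reached
    as a limit.\<close>
  have "((\<lambda>s. norm (\<i> * of_real \<omega> * (of_nat n * g s + s * deriv g s) - lam * g s)) \<longlongrightarrow>
      norm (\<i> * of_real \<omega> * (of_nat n * g 0 + 0 * deriv g 0) - lam * g 0)) (at 0)"
    "((\<lambda>s. \<epsilon> * norm (g s)) \<longlongrightarrow> \<epsilon> * norm (g 0)) (at 0)"
    by (intro tendsto_intros lims)+
  moreover have "\<forall>\<^sub>F s in at 0. norm (\<i> * of_real \<omega> * (of_nat n * g s + s * deriv g s) - lam * g s) \<le> \<epsilon> * norm (g s)"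
  proof -
    have "\<forall>\<^sub>F s in at 0. s \<in> ball 0 r - {0}" using g(2) by (intro eventually_at_in_open) auto
    then show ?thesis by eventually_elim (use est in auto)
  qed
  ultimately have "norm (\<i> * of_real \<omega> * (of_nat n * g 0 + 0 * deriv g 0) - lam * g 0) \<le> \<epsilon> * norm (g 0)"
    by (intro tendsto_le[OF _ _ _]) auto
  also have "\<i> * of_real \<omega> * (of_nat n * g 0 + 0 * deriv g 0) - lam * g 0 = (\<i> * of_real \<omega> * of_nat n - lam) * g 0"
    by (simp add: algebra_simps)
  finally have "norm (\<i> * of_real \<omega> * of_nat n - lam) \<le> \<epsilon>"
    using g(6)[OF r0] by (simp add: norm_mult)
  \<comment> \<open>The eigenvalue \<i> \<omega> n is purely imaginary whatever n is, so it cannot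
    reduce the real part of \<open>lam\<close>.\<close>
  moreover have "\<bar>Re lam\<bar> \<le> norm (\<i> * of_real \<omega> * of_nat n - lam)"
    using abs_Re_le_cmod[of "\<i> * of_real \<omega> * of_nat n - lam"] by simp
  ultimately show ?thesis using \<epsilon> by linarith
qed

text \<open>Quantitative normal form of a defining function whose zero set is tangent to the (x,
  y)-plane: \<alpha> z plus a second-order term. It is instantiated both by the constructed manifold
  and by a competitor.\<close>

locale chart =
  fixes \<Phi> :: "c3 \<Rightarrow> complex" and \<alpha> :: complex and C r :: real
  assumes holo_\<Phi>: "holo3 \<Phi> (ball 0 r)" and \<alpha>: "\<alpha> \<noteq> 0" and C: "0 < C" and r: "0 < r"
    and quad: "\<And>w. norm w < r \<Longrightarrow> norm (\<Phi> w - \<alpha> * snd (snd w)) \<le> C * (norm w)\<^sup>2"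
begin

definition n :: "c3 \<Rightarrow> complex" where
  "n w = \<Phi> w - \<alpha> * snd (snd w)"

lemma holo_n: "holo3 n (ball 0 r)"
proof -
  have "holo3 (\<lambda>w. \<Phi> w + (- \<alpha>) * snd (snd w)) (ball 0 r)"
    by (intro holo3_add holo_\<Phi> holo3_cmult holo3_linear cplx_linear_coord open_ball)
  then show ?thesis by (simp add: n_def[abs_def])
qed

lemma n_Lipschitz:
  assumes "2 * a < r" "norm p \<le> a" "norm q \<le> a"
  shows "norm (n q - n p) \<le> 4 * C * a * norm (q - p)"
  by (rule quadratic_Lipschitz[OF holo3_imp_gholo[OF holo_n order_refl]]) (use assms C quad in \<open>auto simp: n_def\<close>)

lemma \<Phi>_0: "\<Phi> 0 = 0"
  using quad[of 0] r by simp

text \<open>Implicit function theorem on an explicit ball, by Banach's fixed point theorem for z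
  \<mapsto> - n(x, y, z) / \<alpha>. At radius 2 \<rho> the Lipschitz constant of \<open>n\<close>
  is 8 C \<rho>, so 16 C \<rho> \<le> |\<alpha>| gives contraction by 1/2.\<close>

lemma zero_over:
  assumes \<rho>: "4 * \<rho> < r" "16 * C * \<rho> \<le> norm \<alpha>" and xy: "norm (x :: complex, y :: complex, 0 :: complex) \<le> \<rho>"
  obtains z where "norm z \<le> \<rho>" "norm (x, y, z) \<le> 2 * \<rho>" "\<Phi> (x, y, z) = 0"
proof -
  have \<rho>0: "0 \<le> \<rho>" using xy norm_ge_zero order_trans by blast
  have nz: "norm (x, y, z) \<le> 2 * \<rho>" if "norm z \<le> \<rho>" for z :: complex
  proof -
    have "norm ((x, y, 0) + (0, 0, z)) \<le> norm (x, y, 0 :: complex) + norm (0 :: complex, 0 :: complex, z)"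
      by (rule norm_triangle_ineq)
    moreover have "norm (0 :: complex, 0 :: complex, z) = norm z" by (simp add: norm_prod_def)
    ultimately show ?thesis using that xy by simp
  qed
  define T where "T = (\<lambda>z. - n (x, y, z) / \<alpha>)"
  have "\<exists>!z. z \<in> cball 0 \<rho> \<and> T z = z"
  proof (rule Banach_fix[of _ "1/2"])
    show "complete (cball (0::complex) \<rho>)" by (simp add: complete_eq_closed)
    show "cball (0::complex) \<rho> \<noteq> {}" using \<rho>0 by simp
    show "T ` cball 0 \<rho> \<subseteq> cball 0 \<rho>"
    proof (clarsimp simp: T_def norm_divide)
      fix z :: complex assume "norm z \<le> \<rho>"
      note nz = nz[OF this]
      have "norm (n (x, y, z)) \<le> C * (norm (x, y, z))\<^sup>2" using quad[of "(x, y, z)"] nz \<rho> \<rho>0 by (simp add: n_def)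
      also have "\<dots> \<le> C * (2 * \<rho>)\<^sup>2" using C nz by (intro mult_left_mono power_mono) auto
      also have "\<dots> = (4 * C * \<rho>) * \<rho>" by (simp add: power2_eq_square)
      also have "\<dots> \<le> (16 * C * \<rho>) * \<rho>" using C \<rho>0 by (intro mult_right_mono) auto
      also have "\<dots> \<le> norm \<alpha> * \<rho>" using \<rho> \<rho>0 by (intro mult_right_mono) auto
      finally show "norm (n (x, y, z)) / norm \<alpha> \<le> \<rho>" using \<alpha> by (simp add: field_simps)
    qed
    fix z z' :: complex assume z: "z \<in> cball 0 \<rho>" "z' \<in> cball 0 \<rho>"
    have "norm (n (x, y, z) - n (x, y, z')) \<le> 4 * C * (2 * \<rho>) * norm ((x, y, z) - (x, y, z'))"
      by (rule n_Lipschitz) (use \<rho> z nz in auto)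
    also have "\<dots> = (16 * C * \<rho>) * (norm (z - z') / 2)" by (simp add: norm_prod_def)
    also have "\<dots> \<le> norm \<alpha> * (norm (z - z') / 2)" using \<rho> by (intro mult_right_mono) auto
    finally show "dist (T z) (T z') \<le> 1 / 2 * dist z z'"
      using \<alpha> by (simp add: T_def dist_norm norm_divide norm_minus_commute field_simps flip: diff_divide_distrib)
  qed auto
  then obtain z where z: "norm z \<le> \<rho>" "T z = z" by auto
  then have "\<Phi> (x, y, z) = 0" using \<alpha> by (simp add: T_def n_def field_simps)
  then show ?thesis using that[OF z(1) nz[OF z(1)]] by blast
qed

text \<open>On a vertical line the term \<alpha> z dominates, because \<open>n\<close> varies by at
  most half as much. A vertical line thus meets the zero set at most once, and |\<Phi>| bounds the
  vertical distance to it.\<close>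

lemma vertical_expand:
  assumes \<rho>: "4 * \<rho> < r" "16 * C * \<rho> \<le> norm \<alpha>"
    and "norm (x, y, z) \<le> 2 * \<rho>" "norm (x, y, z') \<le> 2 * \<rho>"
  shows "norm \<alpha> / 2 * norm (z - z') \<le> norm (\<Phi> (x, y, z) - \<Phi> (x, y, z'))"
proof -
  have "norm (n (x, y, z) - n (x, y, z')) \<le> 4 * C * (2 * \<rho>) * norm ((x, y, z) - (x, y, z'))"
    by (rule n_Lipschitz) (use assms in auto)
  also have "\<dots> = (16 * C * \<rho>) * (norm (z - z') / 2)" by (simp add: norm_prod_def)
  also have "\<dots> \<le> norm \<alpha> * (norm (z - z') / 2)" using \<rho> by (intro mult_right_mono) auto
  finally have 1: "norm (n (x, y, z) - n (x, y, z')) \<le> norm \<alpha> / 2 * norm (z - z')" by simp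
  have "\<alpha> * (z - z') = (\<Phi> (x, y, z) - \<Phi> (x, y, z')) - (n (x, y, z) - n (x, y, z'))"
    by (simp add: n_def algebra_simps)
  then have "norm \<alpha> * norm (z - z') \<le> norm (\<Phi> (x, y, z) - \<Phi> (x, y, z')) + norm (n (x, y, z) - n (x, y, z'))"
    by (metis norm_mult norm_triangle_ineq4)
  then show ?thesis using 1 by simp
qed

lemma dirderiv_\<Phi>_0: "dirderiv \<Phi> 0 v = \<alpha> * snd (snd v)"
proof -
  have z: "(0::c3) \<in> ball 0 r" using r by simp
  have "norm (dirderiv n 0 v) \<le> 4 * C * e * norm v" if "0 < e" "e < r / 2" for e
    by (rule quadratic_dirderiv[OF holo3_imp_gholo[OF holo_n order_refl]]) (use C quad that in \<open>auto simp: n_def\<close>)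
  then have ev: "\<forall>\<^sub>F e in at_right 0. norm (dirderiv n 0 v) \<le> 4 * C * e * norm v"
    using r by (auto simp: eventually_at_right_field intro: exI[of _ "r / 2"])
  have "((\<lambda>e. 4 * C * e * norm v) \<longlongrightarrow> 0) (at_right 0)" by (auto intro!: tendsto_eq_intros)
  from tendsto_lowerbound[OF this ev] have d0: "dirderiv n 0 v = 0" by simp
  have "(n has_derivative (\<lambda>v. dirderiv \<Phi> 0 v - \<alpha> * snd (snd v))) (at 0)"
    unfolding n_def[abs_def]
    by (intro has_derivative_diff holo3_dirderiv(1)[OF holo_\<Phi> z] has_derivative_mult_right has_derivative_snd has_derivative_ident)
  from has_derivative_unique[OF holo3_dirderiv(1)[OF holo_n z] this]
  have "dirderiv n 0 v = dirderiv \<Phi> 0 v - \<alpha> * snd (snd v)" by metis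
  then show ?thesis using d0 by simp
qed

end

text \<open>The kernel condition leaves only \<alpha> dz, with \<alpha> \<noteq> 0, for the
  differential at 0. What remains has zero derivative there and \<open>quadratic_bound\<close>
  applies.\<close>

lemma chart_exists:
  assumes "holo3 \<Phi> V" "0 \<in> V" "\<Phi> 0 = 0" "\<And>v. dirderiv \<Phi> 0 v = 0 \<longleftrightarrow> snd (snd v) = 0"
  obtains \<alpha> C r where "chart \<Phi> \<alpha> C r" "ball 0 r \<subseteq> V"
proof -
  define \<alpha> where "\<alpha> = dirderiv \<Phi> 0 (0, 0, 1)"
  note d = holo3_dirderiv[OF assms(1,2)]
  have lin: "linear (dirderiv \<Phi> 0)" and sc: "\<And>c v. dirderiv \<Phi> 0 (scaleC3 c v) = c * dirderiv \<Phi> 0 v"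
    using d(2) by (auto simp: cplx_linear_def)
  have eq: "dirderiv \<Phi> 0 v = \<alpha> * snd (snd v)" for v
  proof -
    have "v = (fst v, fst (snd v), 0) + scaleC3 (snd (snd v)) (0, 0, 1)"
      by (simp add: scaleC3_def prod_eq_iff)
    then have "dirderiv \<Phi> 0 v = dirderiv \<Phi> 0 (fst v, fst (snd v), 0) + dirderiv \<Phi> 0 (scaleC3 (snd (snd v)) (0, 0, 1))"
      using linear_add[OF lin] by metis
    then show ?thesis using assms(4)[of "(fst v, fst (snd v), 0)"] sc by (simp add: \<alpha>_def)
  qed
  have V: "open V" using assms(1) by (simp add: holo3_def)
  let ?n = "\<lambda>w. \<Phi> w + (- \<alpha>) * snd (snd w)"
  have hn: "holo3 ?n V"
    by (intro holo3_add assms(1) holo3_cmult holo3_linear cplx_linear_coord V)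
  have "(?n has_derivative (\<lambda>v. dirderiv \<Phi> 0 v + (- \<alpha>) * snd (snd v))) (at 0)"
    by (intro has_derivative_add d(1) has_derivative_mult_right has_derivative_snd has_derivative_ident)
  then have "(?n has_derivative (\<lambda>_. 0)) (at 0)" by (simp add: eq)
  from quadratic_bound[OF hn assms(2) _ this] assms(3)
  obtain r C where rC: "r > 0" "C > 0" "ball 0 r \<subseteq> V" "\<And>w. norm w < r \<Longrightarrow> norm (?n w) \<le> C * (norm w)\<^sup>2"
    by auto
  have "\<alpha> \<noteq> 0" using assms(4)[of "(0, 0, 1)"] by (simp add: \<alpha>_def)
  then have "chart \<Phi> \<alpha> C r"
    by unfold_locales (use rC holo3_subset[OF assms(1) rC(3)] in auto)
  then show ?thesis using that rC(3) by blast
qed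

section \<open>The vector field and the tangency defect of a defining function\<close>

locale center_field =
  fixes \<omega> :: real and lam :: complex and f g h :: "c3 \<Rightarrow> complex" and C r\<^sub>0 :: real
  assumes \<omega>: "\<omega> \<noteq> 0" and lam: "Re lam \<noteq> 0" and C: "0 < C" and r\<^sub>0: "0 < r\<^sub>0"
    and holo: "holo3 f (ball 0 r\<^sub>0)" "holo3 g (ball 0 r\<^sub>0)" "holo3 h (ball 0 r\<^sub>0)"
    and quad: "\<And>w. norm w < r\<^sub>0 \<Longrightarrow> norm (f w) \<le> C * (norm w)\<^sup>2"
      "\<And>w. norm w < r\<^sub>0 \<Longrightarrow> norm (g w) \<le> C * (norm w)\<^sup>2"
      "\<And>w. norm w < r\<^sub>0 \<Longrightarrow> norm (h w) \<le> C * (norm w)\<^sup>2"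
begin

abbreviation X :: "c3 \<Rightarrow> c3" where
  "X \<equiv> sysfield \<omega> lam f g h"

lemma nonlinear_Lipschitz:
  assumes "2 * a < r\<^sub>0" "norm p \<le> a" "norm q \<le> a"
  shows "norm (f q - f p) \<le> 4 * C * a * norm (q - p)" "norm (g q - g p) \<le> 4 * C * a * norm (q - p)"
    "norm (h q - h p) \<le> 4 * C * a * norm (q - p)"
  using C assms
  by (auto intro!: quadratic_Lipschitz[OF holo3_imp_gholo[OF holo(1) order_refl] quad(1)]
    quadratic_Lipschitz[OF holo3_imp_gholo[OF holo(2) order_refl] quad(2)]
    quadratic_Lipschitz[OF holo3_imp_gholo[OF holo(3) order_refl] quad(3)])

lemma nonlinear_0: "f 0 = 0" "g 0 = 0" "h 0 = 0"
  using quad[of 0] r\<^sub>0 by auto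

lemma X_0: "X 0 = 0"
  by (simp add: sysfield_def nonlinear_0 prod_eq_iff)

text \<open>On the ball of radius \<open>r\<^sub>0 / 4\<close> each nonlinearity has Lipschitz
  constant 4 C \<open>r\<^sub>0\<close> / 4, which explains the summand 3 C
  \<open>r\<^sub>0\<close>.\<close>

definition B :: real where
  "B = 2 * \<bar>\<omega>\<bar> + norm lam + 3 * C * r\<^sub>0"

lemma B: "0 \<le> B"
  using C r\<^sub>0 by (auto simp: B_def)

lemma X_Lipschitz:
  assumes "norm p \<le> r\<^sub>0 / 4" "norm q \<le> r\<^sub>0 / 4"
  shows "norm (X q - X p) \<le> B * norm (q - p)"
proof -
  have "2 * (r\<^sub>0 / 4) < r\<^sub>0" using r\<^sub>0 by simp
  note L = nonlinear_Lipschitz[OF this assms]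
  have 1: "norm (fst (X q - X p)) \<le> \<bar>\<omega>\<bar> * norm (q - p) + C * r\<^sub>0 * norm (q - p)"
  proof -
    have "fst (X q - X p) = \<i> * of_real \<omega> * (fst (q - p)) + (f q - f p)"
      by (simp add: sysfield_def algebra_simps)
    also have "norm \<dots> \<le> \<bar>\<omega>\<bar> * norm (q - p) + C * r\<^sub>0 * norm (q - p)"
      using L(1) norm_c3_ge(1)[of "q - p"] by (intro norm_triangle_mono) (auto simp: norm_mult mult_left_mono)
    finally show ?thesis .
  qed
  have 2: "norm (fst (snd (X q - X p))) \<le> \<bar>\<omega>\<bar> * norm (q - p) + C * r\<^sub>0 * norm (q - p)"
  proof -
    have "fst (snd (X q - X p)) = \<i> * of_real \<omega> * (fst (snd (q - p))) + (g q - g p)"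
      by (simp add: sysfield_def algebra_simps)
    also have "norm \<dots> \<le> \<bar>\<omega>\<bar> * norm (q - p) + C * r\<^sub>0 * norm (q - p)"
      using L(2) norm_c3_ge(2)[of "q - p"] by (intro norm_triangle_mono) (auto simp: norm_mult mult_left_mono)
    finally show ?thesis .
  qed
  have 3: "norm (snd (snd (X q - X p))) \<le> norm lam * norm (q - p) + C * r\<^sub>0 * norm (q - p)"
  proof -
    have "snd (snd (X q - X p)) = lam * (snd (snd (q - p))) + (h q - h p)"
      by (simp add: sysfield_def algebra_simps)
    also have "norm \<dots> \<le> norm lam * norm (q - p) + C * r\<^sub>0 * norm (q - p)"
      using L(3) norm_c3_ge(3)[of "q - p"] by (intro norm_triangle_mono) (auto simp: norm_mult mult_left_mono)
    finally show ?thesis .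
  qed
  show ?thesis
    using norm_c3_le[of "X q - X p"] 1 2 3 by (simp add: B_def algebra_simps)
qed

text \<open>At first order both the derivative of \<Phi> along \<open>X\<close> and lam \<Phi> equal
  lam \<alpha> z, so the defect is of second order and its Lipschitz constant shrinks with the
  radius \<open>a\<close>.\<close>

lemma tangency_defect_Lipschitz:
  assumes "chart \<Phi> \<alpha> C' r'"
  obtains K r where "0 < K" "0 < r" "\<And>a p q. a < r \<Longrightarrow> norm p \<le> a \<Longrightarrow> norm q \<le> a \<Longrightarrow>
     norm ((dirderiv \<Phi> q (X q) - lam * \<Phi> q) - (dirderiv \<Phi> p (X p) - lam * \<Phi> p)) \<le> K * a * norm (q - p)"
proof -
  interpret \<Phi>: chart \<Phi> \<alpha> C' r' by fact
  have 0: "(0::c3) \<in> ball 0 r'" using \<Phi>.r by simp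
  obtain s M where s: "s > 0" "M > 0" "ball 0 s \<subseteq> ball (0::c3) r'" "\<And>w. norm w < s \<Longrightarrow> norm (\<Phi> w) \<le> M"
    using holo3_bounded_near[OF \<Phi>.holo_\<Phi> 0] by metis
  define K1 where "K1 = M / (s / 4)\<^sup>2"
  have K1: "0 \<le> K1" using s by (simp add: K1_def)
  have DL: "norm (dirderiv \<Phi> p v - dirderiv \<Phi> q v) \<le> K1 * norm (p - q) * norm v"
    if "norm p \<le> s / 4" "norm q \<le> s / 4" for p q v
    unfolding K1_def
    by (rule dirderiv_Lipschitz[OF holo3_imp_gholo[OF \<Phi>.holo_\<Phi> s(3)], where a = "s / 4"])
      (use that s in auto)
  define K where "K = 2 * K1 * B + 4 * norm \<alpha> * C + 4 * norm lam * C' + 1"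
  define r where "r = Min {s / 4, r\<^sub>0 / 4, r' / 2}"
  show ?thesis
  proof (rule that[of K r])
    show "0 < K" using K1 B C \<Phi>.C by (auto simp: K_def intro!: add_nonneg_pos add_nonneg_nonneg)
    show "0 < r" using s r\<^sub>0 \<Phi>.r by (simp add: r_def)
    fix a and p q :: c3 assume a: "a < r" and p: "norm p \<le> a" and q: "norm q \<le> a"
    have ar: "a < s / 4" "a < r\<^sub>0 / 4" "2 * a < r'" using a by (auto simp: r_def)
    have a0: "0 \<le> a" using p norm_ge_zero order_trans by blast
    have in_r': "p \<in> ball 0 r'" using p ar a0 by simp
    have lin: "linear (dirderiv \<Phi> p)"
      using holo3_dirderiv(2)[OF \<Phi>.holo_\<Phi> in_r'] by (simp add: cplx_linear_def)
    let ?d = "norm (q - p)"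
    have X1: "norm (X q - X p) \<le> B * ?d" by (rule X_Lipschitz) (use p q ar in auto)
    have X2: "norm (X q) \<le> B * a"
    proof -
      have "norm (X q) \<le> B * norm q" using X_Lipschitz[of 0 q] q ar r\<^sub>0 by (simp add: X_0)
      also have "\<dots> \<le> B * a" using q B by (rule mult_left_mono)
      finally show ?thesis .
    qed
    have t1: "norm (dirderiv \<Phi> q (X q) - dirderiv \<Phi> p (X q)) \<le> K1 * B * a * ?d"
    proof -
      have "norm (dirderiv \<Phi> q (X q) - dirderiv \<Phi> p (X q)) \<le> K1 * ?d * norm (X q)"
        by (rule DL) (use p q ar in auto)
      also have "\<dots> \<le> K1 * ?d * (B * a)" using X2 K1 by (intro mult_left_mono) auto
      finally show ?thesis by (simp add: mult_ac)
    qed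
    have t2: "norm (dirderiv \<Phi> p (X q - X p) - dirderiv \<Phi> 0 (X q - X p)) \<le> K1 * B * a * ?d"
    proof -
      have "norm (dirderiv \<Phi> p (X q - X p) - dirderiv \<Phi> 0 (X q - X p)) \<le> K1 * norm (p - 0) * norm (X q - X p)"
        by (rule DL) (use p q ar s in auto)
      also have "\<dots> \<le> K1 * a * (B * ?d)" using X1 K1 p a0 B by (intro mult_mono) auto
      finally show ?thesis by (simp add: mult_ac)
    qed
    have t3: "norm (\<alpha> * (h q - h p)) \<le> 4 * norm \<alpha> * C * a * ?d"
    proof -
      have "norm (\<alpha> * (h q - h p)) \<le> norm \<alpha> * (4 * C * a * ?d)"
        unfolding norm_mult by (intro mult_left_mono nonlinear_Lipschitz) (use p q ar a0 in auto)
      then show ?thesis by (simp add: mult_ac)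
    qed
    have t4: "norm (lam * (\<Phi>.n q - \<Phi>.n p)) \<le> 4 * norm lam * C' * a * ?d"
    proof -
      have "norm (lam * (\<Phi>.n q - \<Phi>.n p)) \<le> norm lam * (4 * C' * a * ?d)"
        unfolding norm_mult by (intro mult_left_mono \<Phi>.n_Lipschitz) (use p q ar in auto)
      then show ?thesis by (simp add: mult_ac)
    qed
    \<comment> \<open>The derivative at 0 is inserted because it is known exactly: its contribution
      lam \<alpha> (z_q - z_p) cancels that of lam \<Phi>.\<close>
    have "(dirderiv \<Phi> q (X q) - lam * \<Phi> q) - (dirderiv \<Phi> p (X p) - lam * \<Phi> p) =
       (dirderiv \<Phi> q (X q) - dirderiv \<Phi> p (X q)) + (dirderiv \<Phi> p (X q - X p) - dirderiv \<Phi> 0 (X q - X p))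
       + \<alpha> * (h q - h p) - lam * (\<Phi>.n q - \<Phi>.n p)"
    proof -
      have "dirderiv \<Phi> 0 (X q - X p) = \<alpha> * (lam * (snd (snd q) - snd (snd p)) + (h q - h p))"
        by (simp add: \<Phi>.dirderiv_\<Phi>_0 sysfield_def algebra_simps)
      then show ?thesis
        by (simp add: linear_diff[OF lin] \<Phi>.n_def algebra_simps)
    qed
    also have "norm \<dots> \<le> K1 * B * a * ?d + K1 * B * a * ?d + 4 * norm \<alpha> * C * a * ?d + 4 * norm lam * C' * a * ?d"
      by (intro order_trans[OF norm_triangle_ineq4] add_mono norm_triangle_mono t1 t2 t3 t4)
    also have "\<dots> = (K - 1) * a * ?d" by (simp add: K_def algebra_simps)
    also have "\<dots> \<le> K * a * ?d" using a0 by (intro mult_right_mono) auto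
    finally show "norm ((dirderiv \<Phi> q (X q) - lam * \<Phi> q) - (dirderiv \<Phi> p (X p) - lam * \<Phi> p)) \<le> K * a * ?d" .
  qed
qed

text \<open>The defect vanishes on \<open>\<Phi> = 0\<close> and has a small Lipschitz constant near 0, so it is
  controlled by the vertical distance to the zero set, hence by \<open>\<Phi>\<close>.\<close>

lemma tangency_defect_small:
  assumes "chart \<Phi> \<alpha> C' r'" and "0 < \<epsilon>"
    and tangent: "\<And>p. norm p < r' \<Longrightarrow> \<Phi> p = 0 \<Longrightarrow> dirderiv \<Phi> p (X p) = 0"
  obtains \<rho> where "0 < \<rho>" "\<rho> < r'" "\<And>p. norm p \<le> \<rho> \<Longrightarrow> norm (dirderiv \<Phi> p (X p) - lam * \<Phi> p) \<le> \<epsilon> * norm (\<Phi> p)"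
proof -
  interpret \<Phi>: chart \<Phi> \<alpha> C' r' by fact
  obtain K r where K: "0 < K" "0 < r" "\<And>a p q. a < r \<Longrightarrow> norm p \<le> a \<Longrightarrow> norm q \<le> a \<Longrightarrow>
     norm ((dirderiv \<Phi> q (X q) - lam * \<Phi> q) - (dirderiv \<Phi> p (X p) - lam * \<Phi> p)) \<le> K * a * norm (q - p)"
    using tangency_defect_Lipschitz[OF assms(1)] by metis
  \<comment> \<open>The last entry makes the Lipschitz constant 2 K \<rho> of the defect at most
    \<epsilon> |\<alpha>| / 2, which is \<epsilon> times the constant of
    \<open>vertical_expand\<close>. The others meet the radius conditions of the lemmas
    used.\<close>
  define \<rho> where "\<rho> = Min {r / 4, r' / 8, norm \<alpha> / (16 * C'), \<epsilon> * norm \<alpha> / (4 * K)}"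
  have \<rho>0: "0 < \<rho>" using K \<Phi>.r \<Phi>.C \<Phi>.\<alpha> assms(2) by (auto simp: \<rho>_def)
  have "\<rho> \<le> r / 4" "\<rho> \<le> r' / 8" "\<rho> \<le> norm \<alpha> / (16 * C')" "\<rho> \<le> \<epsilon> * norm \<alpha> / (4 * K)"
    by (auto simp: \<rho>_def)
  then have \<rho>: "2 * \<rho> < r" "4 * \<rho> < r'" "16 * C' * \<rho> \<le> norm \<alpha>" "4 * K * \<rho> \<le> \<epsilon> * norm \<alpha>"
    using \<rho>0 K \<Phi>.C by (auto simp: field_simps)
  show ?thesis
  proof (rule that[OF \<rho>0])
    show "\<rho> < r'" using \<rho> \<rho>0 by simp
    fix p :: c3 assume p: "norm p \<le> \<rho>"
    obtain x y z where xyz: "p = (x, y, z)" by (cases p)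
    have "norm (x, y, 0 :: complex) \<le> norm p"
      unfolding xyz norm_prod_def by (auto intro!: real_sqrt_le_mono)
    then obtain z' where z': "norm (x, y, z') \<le> 2 * \<rho>" "\<Phi> (x, y, z') = 0"
      using \<Phi>.zero_over[OF \<rho>(2,3), of x y] p by (metis order_trans)
    let ?p' = "(x, y, z')"
    have p2: "norm p \<le> 2 * \<rho>" using p \<rho>0 by simp
    have "norm ?p' < r'" using z'(1) \<rho>(2) \<rho>0 by linarith
    then have "dirderiv \<Phi> ?p' (X ?p') - lam * \<Phi> ?p' = 0" using tangent z'(2) by simp
    then have "norm (dirderiv \<Phi> p (X p) - lam * \<Phi> p) \<le> K * (2 * \<rho>) * norm (p - ?p')"
      using K(3)[OF \<rho>(1) z'(1) p2] by simp
    also have "norm (p - ?p') = norm (z - z')" by (simp add: xyz norm_prod_def)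
    also have "K * (2 * \<rho>) * norm (z - z') = (4 * K * \<rho>) * (norm (z - z') / 2)" by simp
    also have "\<dots> \<le> (\<epsilon> * norm \<alpha>) * (norm (z - z') / 2)" using \<rho>(4) by (rule mult_right_mono) simp
    also have "\<dots> = \<epsilon> * (norm \<alpha> / 2 * norm (z - z'))" by simp
    also have "\<dots> \<le> \<epsilon> * norm (\<Phi> p)"
      using \<Phi>.vertical_expand[OF \<rho>(2,3), of x y z z'] p2 z' xyz assms(2) by (intro mult_left_mono) auto
    finally show "norm (dirderiv \<Phi> p (X p) - lam * \<Phi> p) \<le> \<epsilon> * norm (\<Phi> p)" .
  qed
qed

end

section \<open>The linearized center manifold\<close>

context center_field
begin

text \<open>The direction \<open>c\<close> of complex time is chosen such that \<open>Re c = 1\<close> and \<open>c * lam\<close> is real,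
  so that along the spiral \<open>exp (c * \<sigma>)\<close> the \<open>z\<close>-direction is neutral and the \<open>(x, y)\<close>-directions
  are contracted as \<open>\<sigma>\<close> tends to \<open>-\<infinity>\<close>.\<close>

lemma linearizing_map:
  obtains R K r a where "near_identity R K r a" "16 * a \<le> r\<^sub>0"
    "\<And>u. norm u < a \<Longrightarrow> snd (snd u) = 0 \<Longrightarrow>
       scaleC3 (\<i> * of_real \<omega>) (dirderiv_map (near_identity.\<Theta> R) u u) = X (near_identity.\<Theta> R u)"
proof -
  define c where "c = Complex 1 (- Im lam / Re lam)"
  \<comment> \<open>Multiplying the field by \<kappa> turns the double eigenvalue \<i> \<omega> into
    \<open>c\<close>, and \<open>lam\<close> into the purely imaginary number c lam / (\<i>
    \<omega>).\<close>
  define \<kappa> where "\<kappa> = c / (\<i> * of_real \<omega>)"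
  have c0: "c \<noteq> 0" by (simp add: c_def complex_eq_iff)
  have \<kappa>: "\<kappa> \<noteq> 0" "c = \<kappa> * (\<i> * of_real \<omega>)" using c0 \<omega> by (auto simp: \<kappa>_def)
  have "Im (c * lam) = 0" using lam by (simp add: c_def)
  then have "Re (\<kappa> * lam) = 0" by (simp add: \<kappa>_def Re_divide Im_divide)
  then have b: "Re (\<kappa> * lam) \<le> 1" by simp
  define C2 where "C2 = norm \<kappa> * C"
  have C2: "0 < C2" using \<kappa> C by (simp add: C2_def)
  define r where "r = min (r\<^sub>0 / 4) (1 / (48 * C2))"
  have r: "0 < r" "4 * r \<le> r\<^sub>0" "48 * C2 * r \<le> 1"
  proof -
    show "0 < r" "4 * r \<le> r\<^sub>0" using r\<^sub>0 C2 by (auto simp: r_def)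
    have "48 * C2 * r \<le> 48 * C2 * (1 / (48 * C2))" using C2 by (intro mult_left_mono) (auto simp: r_def)
    then show "48 * C2 * r \<le> 1" using C2 by simp
  qed
  interpret P: spiral_picard c "\<kappa> * lam" "\<lambda>p. \<kappa> * f p" "\<lambda>p. \<kappa> * g p" "\<lambda>p. \<kappa> * h p" C2 r\<^sub>0 r
    by unfold_locales
      (use b C2 r holo quad in \<open>auto simp: c_def C2_def norm_mult mult.assoc intro!: holo3_cmult mult_left_mono\<close>)
  \<comment> \<open>The entries provide, in order, 2 a < r, the smallness condition of
    \<open>near_identity\<close> for K = 12 C2, and 16 a \<le> \<open>r\<^sub>0\<close>.\<close>
  define a where "a = Min {r / 3, 1 / (24 * (12 * C2)), r\<^sub>0 / 16}"
  have "0 < a" using r C2 r\<^sub>0 by (simp add: a_def)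
  have al: "a \<le> r / 3" "a \<le> 1 / (24 * (12 * C2))" "a \<le> r\<^sub>0 / 16" by (auto simp: a_def)
  have "24 * (12 * C2) * a \<le> 24 * (12 * C2) * (1 / (24 * (12 * C2)))"
    using C2 al(2) by (intro mult_left_mono) auto
  also have "\<dots> = 1" using C2 by simp
  finally have a24: "24 * (12 * C2) * a \<le> 1" .
  interpret I: near_identity P.remainder "12 * C2" r a
    by unfold_locales (use P.remainder_props C2 \<open>0 < a\<close> al r a24 in auto)
  show ?thesis
  proof (rule that[of P.remainder "12 * C2" r a])
    show "near_identity P.remainder (12 * C2) r a" by unfold_locales
    show "16 * a \<le> r\<^sub>0" using al by simp
    fix u :: c3 assume u: "norm u < a" "snd (snd u) = 0"
    have ur: "norm u < r" using u al r by linarith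
    note E = P.remainder_equation[OF ur]
    let ?D = "dirderiv_map P.remainder u u"
    \<comment> \<open>Cancelling \<kappa> leads from the time direction \<open>c\<close> back to
      real time. The linear terms agree because x and y have the same eigenvalue as the model
      field.\<close>
    have xy: "\<i> * of_real \<omega> * (x + d) = \<i> * of_real \<omega> * (x + y) + n" if "c * d = c * y + \<kappa> * n" for x y d n
    proof -
      have "\<kappa> * (\<i> * of_real \<omega> * d) = \<kappa> * (\<i> * of_real \<omega> * y + n)"
        using that unfolding \<kappa>(2) by (simp add: algebra_simps)
      then have "\<i> * of_real \<omega> * d = \<i> * of_real \<omega> * y + n" using \<kappa>(1) by simp
      then show ?thesis by (simp add: distrib_left)
    qed
    have z: "\<i> * of_real \<omega> * d = lam * y + n" if "c * d = \<kappa> * lam * y + \<kappa> * n" for y d n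
    proof -
      have "\<kappa> * (\<i> * of_real \<omega> * d) = \<kappa> * (lam * y + n)"
        using that unfolding \<kappa>(2) by (simp add: algebra_simps)
      then show ?thesis using \<kappa>(1) by simp
    qed
    show "scaleC3 (\<i> * of_real \<omega>) (dirderiv_map I.\<Theta> u u) = X (I.\<Theta> u)"
      unfolding I.dirderiv_\<Theta>[OF ur]
      using xy[OF E(1), of "fst u"] xy[OF E(2), of "fst (snd u)"] z[OF E(3)] u(2)
      by (simp add: prod_eq_iff sysfield_def dirderiv_map_def I.\<Theta>_def)
  qed
qed

end

text \<open>The conjugacy is stated at points of the plane z = 0, where the vector \<i> \<omega> u
  is the velocity of the rotation of \<open>u\<close>. The bound on \<open>a\<close> keeps the image
  of \<Theta> in the ball on which \<open>X\<close> is Lipschitz.\<close>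

locale linearized = center_field \<omega> lam f g h C r\<^sub>0 + near_identity R K r a
  for \<omega> lam f g h C r\<^sub>0 R K r a +
  fixes U :: "c3 set"
  assumes U: "ball 0 r\<^sub>0 \<subseteq> U" and a_small: "16 * a \<le> r\<^sub>0"
    and conj: "\<And>u. norm u < a \<Longrightarrow> snd (snd u) = 0 \<Longrightarrow>
       scaleC3 (\<i> * of_real \<omega>) (dirderiv_map \<Theta> u u) = X (\<Theta> u)"
begin

definition S :: "c3 set" where
  "S = {\<Theta> u |u. norm u < a \<and> snd (snd u) = 0}"

lemma image_small: "norm u < a \<Longrightarrow> norm (\<Theta> u) < r\<^sub>0 / 4"
  using \<Theta>_small[of u] a_small a(1) by simp

lemma image_subset: "\<Theta> ` ball 0 a \<subseteq> U"
proof
  fix p assume "p \<in> \<Theta> ` ball 0 a"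
  then obtain u where "p = \<Theta> u" "norm u < a" by auto
  then have "norm p < r\<^sub>0" using image_small[of u] r\<^sub>0 by simp
  then show "p \<in> U" using U by auto
qed

lemma zero_in_image: "0 \<in> \<Theta> ` ball 0 a"
  using R_0(2) a(1) by (metis centre_in_ball image_eqI)

lemma \<Phi>_0: "\<Phi> 0 = 0"
  using \<Phi>_\<Theta>[of 0] R_0(2) a(1) by simp

lemma S_iff: "p \<in> \<Theta> ` ball 0 a \<Longrightarrow> p \<in> S \<longleftrightarrow> \<Phi> p = 0"
  unfolding S_def using \<Phi>_\<Theta> by auto

lemma frechet_\<Phi>_0: "frechet_derivative \<Phi> (at 0) v = snd (snd v)"
  using frechet_\<Phi>[of 0 v] a(1) R_0(2) dirderiv_\<Theta>_0 by simp

lemma dirderiv_scale_\<Theta>: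
  "norm u < a \<Longrightarrow> dirderiv_map \<Theta> u (scaleC3 k v) = scaleC3 k (dirderiv_map \<Theta> u v)"
  using holo3_map_derivative(2)[OF holo_\<Theta>, of u] a by simp

text \<open>The differential of \<Phi> at \<Theta> u reads off the third coordinate of v from
  D\<Theta>(u) v. It is nonzero on v = (0, 0, 1), and it kills the field, which is the image of v =
  \<i> \<omega> u with third coordinate 0.\<close>

lemma xy_center_manifold_S: "xy_center_manifold U X S"
  unfolding xy_center_manifold_def
proof (intro exI[of _ "\<Theta> ` ball 0 a"] exI[of _ \<Phi>] conjI ballI impI allI)
  show "S \<inter> \<Theta> ` ball 0 a = {p \<in> \<Theta> ` ball 0 a. \<Phi> p = 0}" using S_iff by blast
  fix p assume "p \<in> \<Theta> ` ball 0 a" and p0: "\<Phi> p = 0"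
  then obtain u where u: "p = \<Theta> u" "norm u < a" by auto
  have u3: "snd (snd u) = 0" using p0 \<Phi>_\<Theta>[OF u(2)] u(1) by simp
  show "frechet_derivative \<Phi> (at p) \<noteq> (\<lambda>_. 0)"
    using frechet_\<Phi>[OF u(2), of "(0, 0, 1)"] u(1) by auto
  show "frechet_derivative \<Phi> (at p) (X p) = 0"
    using frechet_\<Phi>[OF u(2), of "scaleC3 (\<i> * of_real \<omega>) u"] conj[OF u(2) u3] u3
      dirderiv_scale_\<Theta>[OF u(2)] u(1) by simp
qed (use open_image zero_in_image image_subset holo_\<Phi> \<Phi>_0 frechet_\<Phi>_0 in auto)

lemma trajectory_rotation:
  assumes u: "norm u < a" "snd (snd u) = 0"
  shows "((\<lambda>t. \<Theta> (scaleC3 (exp (\<i> * of_real \<omega> * of_real t)) u)) has_vector_derivative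
     X (\<Theta> (scaleC3 (exp (\<i> * of_real \<omega> * of_real t)) u))) (at t)"
proof -
  let ?e = "\<lambda>t::real. exp (\<i> * of_real \<omega> * of_real t)"
  have n: "norm (?e t) = 1" for t by (simp add: norm_exp_eq_Re)
  have ut: "norm (scaleC3 (?e t) u) < a" "snd (snd (scaleC3 (?e t) u)) = 0" using n u by auto
  have "(?e has_vector_derivative (\<i> * of_real \<omega> * ?e t)) (at t)"
  proof -
    have "((\<lambda>t. \<i> * of_real \<omega> * complex_of_real t) has_vector_derivative \<i> * of_real \<omega>) (at t)"
      by (auto intro!: derivative_eq_intros)
    from field_vector_diff_chain_at[OF this DERIV_exp] show ?thesis by (simp add: o_def)
  qed
  then have e: "(?e has_derivative (\<lambda>h. h *\<^sub>R (\<i> * of_real \<omega> * ?e t))) (at t)"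
    by (simp add: has_vector_derivative_def)
  have "((\<lambda>t. scaleC3 (?e t) u) has_derivative (\<lambda>h. scaleC3 (h *\<^sub>R (\<i> * of_real \<omega> * ?e t)) u)) (at t)"
    using has_derivative_compose[OF e scaleC3_line_has_derivative[of 0 u]] by simp
  moreover have "(\<Theta> has_derivative dirderiv_map \<Theta> (scaleC3 (?e t) u)) (at (scaleC3 (?e t) u))"
    by (rule holo3_map_derivative(1)[OF holo_\<Theta>]) (use ut a in auto)
  ultimately have "((\<lambda>t. \<Theta> (scaleC3 (?e t) u)) has_derivative
     (\<lambda>h. dirderiv_map \<Theta> (scaleC3 (?e t) u) (scaleC3 (h *\<^sub>R (\<i> * of_real \<omega> * ?e t)) u))) (at t)"
    by (rule has_derivative_compose)
  moreover have "dirderiv_map \<Theta> (scaleC3 (?e t) u) (scaleC3 (h *\<^sub>R (\<i> * of_real \<omega> * ?e t)) u) =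
      h *\<^sub>R X (\<Theta> (scaleC3 (?e t) u))" for h
  proof -
    have "scaleC3 (h *\<^sub>R (\<i> * of_real \<omega> * ?e t)) u = scaleC3 (of_real h) (scaleC3 (\<i> * of_real \<omega>) (scaleC3 (?e t) u))"
      by (simp add: scaleR_conv_of_real mult.assoc)
    then show ?thesis
      using dirderiv_scale_\<Theta>[OF ut(1)] conj[OF ut] by (metis scaleC3_of_real)
  qed
  ultimately show ?thesis by (simp add: has_vector_derivative_def)
qed

lemma isochronous_S: "isochronous_center_family U X S (2 * pi / \<bar>\<omega>\<bar>)"
  unfolding isochronous_center_family_def
\<comment> \<open>Any positive radius serves: \<open>S\<close> is already cut down so far that all
  its nonzero points have the required trajectories.\<close>
proof (intro exI[of _ 1] conjI ballI impI allI)
  fix p assume "p \<in> S" and p: "p \<noteq> 0 \<and> norm p < 1"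
  then obtain u where u: "p = \<Theta> u" "norm u < a" "snd (snd u) = 0"
    unfolding S_def by blast
  have "u \<noteq> 0" using u(1) p R_0(2) by auto
  define \<gamma>\<^sub>0 where "\<gamma>\<^sub>0 = (\<lambda>t::real. \<Theta> (scaleC3 (exp (\<i> * of_real \<omega> * of_real t)) u))"
  have n: "norm (scaleC3 (exp (\<i> * of_real \<omega> * of_real t)) u) < a" for t :: real
    using u(2) by (simp add: norm_exp_eq_Re)
  have small: "norm (\<gamma>\<^sub>0 t) < r\<^sub>0 / 4" for t unfolding \<gamma>\<^sub>0_def by (rule image_small[OF n])
  have d: "(\<gamma>\<^sub>0 has_vector_derivative X (\<gamma>\<^sub>0 t)) (at t)" for t
    unfolding \<gamma>\<^sub>0_def by (rule trajectory_rotation[OF u(2,3)])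
  have in_U: "\<gamma>\<^sub>0 t \<in> U" for t
    using image_subset n[of t] by (auto simp: \<gamma>\<^sub>0_def)
  have start: "\<gamma>\<^sub>0 0 = p" by (simp add: \<gamma>\<^sub>0_def u(1))
  show "\<exists>\<gamma>. trajectory U X p \<gamma>"
    using d start in_U by (auto simp: trajectory_def intro!: exI[of _ \<gamma>\<^sub>0])
  have eq_iff: "\<gamma>\<^sub>0 s = \<gamma>\<^sub>0 t \<longleftrightarrow> exp (\<i> * of_real \<omega> * of_real s) = exp (\<i> * of_real \<omega> * of_real t)" for s t
  proof
    assume "\<gamma>\<^sub>0 s = \<gamma>\<^sub>0 t"
    then have "scaleC3 (exp (\<i> * of_real \<omega> * of_real s)) u = scaleC3 (exp (\<i> * of_real \<omega> * of_real t)) u"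
      using inj_onD[OF inj_\<Theta>] n by (simp add: \<gamma>\<^sub>0_def)
    then show "exp (\<i> * of_real \<omega> * of_real s) = exp (\<i> * of_real \<omega> * of_real t)"
      using \<open>u \<noteq> 0\<close> u(3) by (auto simp: scaleC3_def prod_eq_iff)
  qed (simp add: \<gamma>\<^sub>0_def)
  have exp_iff: "exp (\<i> * of_real \<omega> * of_real s) = exp (\<i> * of_real \<omega> * of_real t) \<longleftrightarrow>
      (\<exists>k::int. \<omega> * s = \<omega> * t + 2 * of_int k * pi)" for s t
    unfolding exp_eq by (auto simp: complex_eq_iff)
  have per: "periodic_with_period \<gamma>\<^sub>0 (2 * pi / \<bar>\<omega>\<bar>)"
    unfolding periodic_with_period_def eq_iff exp_iff
  proof (intro conjI allI impI)
    show "0 < 2 * pi / \<bar>\<omega>\<bar>" using \<omega> by simp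
    fix t :: real
    show "\<exists>k::int. \<omega> * (t + 2 * pi / \<bar>\<omega>\<bar>) = \<omega> * t + 2 * of_int k * pi"
      \<comment> \<open>For negative \<omega> the positive time 2 pi / |\<omega>| is one turn in the
        negative sense.\<close>
      using \<omega> by (intro exI[of _ "if \<omega> > 0 then 1 else - 1"]) (auto simp: field_simps abs_if)
  next
    fix s :: real assume s: "0 < s \<and> s < 2 * pi / \<bar>\<omega>\<bar>"
    show "\<nexists>k::int. \<omega> * s = \<omega> * 0 + 2 * of_int k * pi"
    proof
      assume "\<exists>k::int. \<omega> * s = \<omega> * 0 + 2 * of_int k * pi"
      then obtain k :: int where k: "\<omega> * s = 2 * of_int k * pi" by auto
      have "\<bar>\<omega>\<bar> * s = 2 * pi * \<bar>of_int k\<bar>"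
        using k s by (metis abs_mult abs_numeral abs_of_pos mult.assoc mult.commute pi_gt_zero)
      moreover have "0 < \<bar>\<omega>\<bar> * s" "\<bar>\<omega>\<bar> * s < 2 * pi" using s \<omega> by (auto simp: field_simps)
      ultimately have "0 < \<bar>of_int k :: real\<bar>" "\<bar>of_int k :: real\<bar> < 1"
        by (auto simp: zero_less_mult_iff)
      then show False by simp
    qed
  qed
  fix \<gamma> assume "trajectory U X p \<gamma>"
  then have \<gamma>: "\<gamma> 0 = \<gamma>\<^sub>0 0" "\<And>t. (\<gamma> has_vector_derivative X (\<gamma> t)) (at t)"
    using start by (auto simp: trajectory_def)
  \<comment> \<open>Uniqueness is applied with the explicit rotation as the solution known to stay
    small; nothing is known about the size of \<gamma>.\<close>
  have "\<gamma> t = \<gamma>\<^sub>0 t" for t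
    by (rule ode_unique[OF B _ \<gamma>(2) d small \<gamma>(1)]) (rule X_Lipschitz; simp)
  then have "\<gamma> = \<gamma>\<^sub>0" by auto
  then show "periodic_with_period \<gamma> (2 * pi / \<bar>\<omega>\<bar>)" using per by simp
qed auto

text \<open>On the complex line through \<open>u\<close> the field is \<i> \<omega> s d/ds, so the
  bound on the defect becomes the singular inequality for \<Psi> (\<Theta> (s u)). The disc has
  radius 2 to contain s = 1 in its interior; the factors 2 and 4 in the hypotheses come from |s u|
  \<le> 2 |u| and |\<Theta> v| \<le> 2 |v|.\<close>

lemma vanishing_along_S:
  assumes "chart \<Psi> \<alpha> C' r'" and \<rho>: "\<rho> < r'"
    and defect: "\<And>p. norm p \<le> \<rho> \<Longrightarrow> norm (dirderiv \<Psi> p (X p) - lam * \<Psi> p) \<le> \<bar>Re lam\<bar> / 2 * norm (\<Psi> p)"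
    and u: "2 * norm u < a" "4 * norm u \<le> \<rho>" "snd (snd u) = 0"
  shows "\<Psi> (\<Theta> u) = 0"
proof -
  interpret \<Psi>: chart \<Psi> \<alpha> C' r' by fact
  define w where "w = (\<lambda>s. \<Psi> (\<Theta> (scaleC3 s u)))"
  have su: "norm (scaleC3 s u) < a" "norm (\<Theta> (scaleC3 s u)) \<le> \<rho>" if "s \<in> ball 0 2" for s
  proof -
    have "norm (scaleC3 s u) \<le> 2 * norm u" using that by (simp add: mult_right_mono)
    then show "norm (scaleC3 s u) < a" using u by linarith
    then show "norm (\<Theta> (scaleC3 s u)) \<le> \<rho>"
      using \<Theta>_small[of "scaleC3 s u"] \<open>norm (scaleC3 s u) \<le> 2 * norm u\<close> u by linarith
  qed
  have dw: "(w has_field_derivative dirderiv \<Psi> (\<Theta> (scaleC3 s u)) (dirderiv_map \<Theta> (scaleC3 s u) u)) (at s)"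
    if s: "s \<in> ball 0 2" for s
  proof -
    let ?q = "scaleC3 s u"
    have q: "?q \<in> ball 0 r" "\<Theta> ?q \<in> ball 0 r'" using su[OF s] a \<rho> by auto
    note T = holo3_map_derivative[OF holo_\<Theta> q(1)] and P = holo3_dirderiv[OF \<Psi>.holo_\<Phi> q(2)]
    have "((\<lambda>p. \<Psi> (\<Theta> p)) has_derivative (\<lambda>v. dirderiv \<Psi> (\<Theta> ?q) (dirderiv_map \<Theta> ?q v))) (at (0 + ?q))"
      using has_derivative_compose[OF T(1) P(1)] by simp
    from line_field_derivative[OF this cplx_linear_compose[OF P(2) has_derivative_linear[OF T(1)] T(2)]]
    show ?thesis by (simp add: w_def)
  qed
  have "w 1 = 0"
  proof (rule holomorphic_zero_of_singular_ode[of w 2 \<omega> lam "\<bar>Re lam\<bar> / 2"])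
    show "w holomorphic_on ball 0 2" unfolding holomorphic_on_open[OF open_ball] using dw by blast
    show "w 0 = 0" by (simp add: w_def R_0 \<Psi>.\<Phi>_0)
    fix s :: complex assume s: "s \<in> ball 0 2"
    let ?q = "scaleC3 s u"
    have "\<Theta> ?q \<in> ball 0 r'" using su(2)[OF s] \<rho> by simp
    then have sc: "dirderiv \<Psi> (\<Theta> ?q) (scaleC3 k v) = k * dirderiv \<Psi> (\<Theta> ?q) v" for k v
      using holo3_dirderiv(2)[OF \<Psi>.holo_\<Phi>] by (auto simp: cplx_linear_def)
    have "X (\<Theta> ?q) = scaleC3 (\<i> * of_real \<omega> * s) (dirderiv_map \<Theta> ?q u)"
      using conj[OF su(1)[OF s]] u(3) dirderiv_scale_\<Theta>[OF su(1)[OF s], of s u] by simp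
    then have "dirderiv \<Psi> (\<Theta> ?q) (X (\<Theta> ?q)) = \<i> * of_real \<omega> * s * deriv w s"
      using DERIV_imp_deriv[OF dw[OF s]] by (simp add: sc)
    then show "norm (\<i> * of_real \<omega> * s * deriv w s - lam * w s) \<le> \<bar>Re lam\<bar> / 2 * norm (w s)"
      using defect[OF su(2)[OF s]] by (simp add: w_def)
  qed (use lam in auto)
  then show ?thesis by (simp add: w_def)
qed

text \<open>\<open>vanishing_along_S\<close> gives one inclusion, that \<open>S\<close> lies in S'.
  Conversely, above the (x, y)-coordinates of a point of S' lies a point of \<open>S\<close>, which
  is then a second point of S' on the same vertical line; \<open>vertical_expand\<close> for \<Psi>
  makes the two coincide.\<close>

lemma same_germ_S:
  assumes "xy_center_manifold U X S'"
  shows "same_germ0 S S'"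
proof -
  obtain V \<Psi> where V: "open V" "0 \<in> V" "holo3 \<Psi> V" "\<Psi> 0 = 0" "S' \<inter> V = {p \<in> V. \<Psi> p = 0}"
    "\<And>v. frechet_derivative \<Psi> (at 0) v = 0 \<longleftrightarrow> snd (snd v) = 0"
    "\<And>p. p \<in> V \<Longrightarrow> \<Psi> p = 0 \<Longrightarrow> frechet_derivative \<Psi> (at p) (X p) = 0"
    using assms unfolding xy_center_manifold_def by blast
  have fd: "frechet_derivative \<Psi> (at p) = dirderiv \<Psi> p" if "p \<in> V" for p
    using frechet_derivative_at[OF holo3_dirderiv(1)[OF V(3) that]] by simp
  obtain \<alpha> C' r' where ch': "chart \<Psi> \<alpha> C' r'" and r': "ball 0 r' \<subseteq> V"
    using chart_exists[OF V(3,2,4)] V(6) fd[OF V(2)] by metis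
  interpret \<Psi>: chart \<Psi> \<alpha> C' r' by fact
  have "frechet_derivative \<Phi> (at 0) = dirderiv \<Phi> 0"
    using frechet_derivative_at[OF holo3_dirderiv(1)[OF holo_\<Phi> zero_in_image]] by simp
  then have "dirderiv \<Phi> 0 v = 0 \<longleftrightarrow> snd (snd v) = 0" for v using frechet_\<Phi>_0 by simp
  then obtain \<beta> C'' r'' where ch'': "chart \<Phi> \<beta> C'' r''" and r'': "ball 0 r'' \<subseteq> \<Theta> ` ball 0 a"
    using chart_exists[OF holo_\<Phi> zero_in_image \<Phi>_0] by metis
  interpret \<Phi>: chart \<Phi> \<beta> C'' r'' by fact
  have "0 < \<bar>Re lam\<bar> / 2" using lam by simp
  moreover have "dirderiv \<Psi> p (X p) = 0" if "norm p < r'" "\<Psi> p = 0" for p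
  proof -
    have "p \<in> V" using that(1) r' by auto
    then show ?thesis using V(7) fd that(2) by metis
  qed
  ultimately obtain \<rho> where \<rho>: "0 < \<rho>" "\<rho> < r'"
    "\<And>p. norm p \<le> \<rho> \<Longrightarrow> norm (dirderiv \<Psi> p (X p) - lam * \<Psi> p) \<le> \<bar>Re lam\<bar> / 2 * norm (\<Psi> p)"
    using tangency_defect_small[OF ch'] by metis
  \<comment> \<open>Stated in terms of \<open>p\<close> rather than its preimage \<open>u\<close>;
    |u| \<le> 2 |p| doubles the constants.\<close>
  have incl: "\<Psi> p = 0" if p: "\<Phi> p = 0" "norm p < r''" "4 * norm p < a" "8 * norm p \<le> \<rho>" for p
  proof -
    have "p \<in> \<Theta> ` ball 0 a" using p(2) r'' by auto
    then obtain u where u: "p = \<Theta> u" "norm u < a" by auto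
    have "norm u \<le> 2 * norm p" using \<Theta>_expand[of 0 u] u a(1) R_0(2) by simp
    then show ?thesis
      unfolding u(1)
      by (intro vanishing_along_S[OF ch' \<rho>(2,3)]) (use u p \<Phi>_\<Theta> in auto)
  qed
  \<comment> \<open>The companion point in \<open>S\<close> has norm up to 2 \<eta>, and
    \<open>incl\<close> must still apply to it: hence a / 16 and \<rho> / 16. The first four entries
    serve \<open>vertical_expand\<close> for \<Psi> and \<open>zero_over\<close> for \<Phi>.\<close>
  define \<eta> where "\<eta> = Min {r' / 8, r'' / 8, norm \<alpha> / (16 * C'), norm \<beta> / (16 * C''), a / 16, \<rho> / 16}"
  have \<eta>0: "0 < \<eta>"
    using \<Psi>.r \<Phi>.r \<Psi>.\<alpha> \<Phi>.\<alpha> \<Psi>.C \<Phi>.C a(1) \<rho>(1) by (simp add: \<eta>_def)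
  have "\<eta> \<le> r' / 8" "\<eta> \<le> r'' / 8" "\<eta> \<le> norm \<alpha> / (16 * C')" "\<eta> \<le> norm \<beta> / (16 * C'')" "\<eta> \<le> a / 16" "\<eta> \<le> \<rho> / 16"
    by (auto simp: \<eta>_def)
  then have \<eta>: "4 * \<eta> < r'" "4 * \<eta> < r''" "16 * C' * \<eta> \<le> norm \<alpha>" "16 * C'' * \<eta> \<le> norm \<beta>" "8 * \<eta> < a" "16 * \<eta> \<le> \<rho>"
    using \<eta>0 \<Psi>.C \<Phi>.C by (auto simp: field_simps)
  have "p \<in> S \<longleftrightarrow> p \<in> S'" if p: "norm p < \<eta>" for p
  proof -
    have pV: "p \<in> V" "p \<in> \<Theta> ` ball 0 a" using p \<eta> \<eta>0 r' r'' by auto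
    have "p \<in> S \<longleftrightarrow> \<Phi> p = 0" by (rule S_iff[OF pV(2)])
    moreover have "p \<in> S' \<longleftrightarrow> \<Psi> p = 0" using V(5) pV(1) by blast
    moreover have "\<Psi> p = 0" if "\<Phi> p = 0" by (rule incl[OF that]) (use p \<eta> \<eta>0 in auto)
    moreover have "\<Phi> p = 0" if "\<Psi> p = 0"
    proof -
      obtain x y z where xyz: "p = (x, y, z)" by (cases p)
      have "norm (x, y, 0 :: complex) \<le> norm p"
        unfolding xyz norm_prod_def by (auto intro!: real_sqrt_le_mono)
      then have "norm (x, y, 0 :: complex) \<le> \<eta>" using p by linarith
      then obtain z' where z': "norm (x, y, z') \<le> 2 * \<eta>" "\<Phi> (x, y, z') = 0"
        using \<Phi>.zero_over[OF \<eta>(2,4)] by metis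
      have "\<Psi> (x, y, z') = 0" by (rule incl[OF z'(2)]) (use z'(1) \<eta> \<eta>0 in linarith)+
      then have "norm \<alpha> / 2 * norm (z - z') \<le> 0"
        using \<Psi>.vertical_expand[OF \<eta>(1,3), of x y z z'] that xyz p z'(1) \<eta>0 by simp
      then have "z = z'" using \<Psi>.\<alpha> by (simp add: mult_le_0_iff)
      then show ?thesis using z'(2) xyz by simp
    qed
    ultimately show ?thesis by blast
  qed
  then show ?thesis
    unfolding same_germ0_def by (intro exI[of _ "ball 0 \<eta>"]) (use \<eta>0 in auto)
qed

end

theorem theorem3p3:
  fixes \<omega> :: real and lam :: complex and f g h :: "c3 \<Rightarrow> complex" and U :: "c3 set"
  assumes "\<omega> \<noteq> 0" and "Re lam \<noteq> 0"
    and "open U" and "0 \<in> U"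
    and "holo3 f U" and "holo3 g U" and "holo3 h U"
    and "vanish_order2 f" and "vanish_order2 g" and "vanish_order2 h"
  shows "\<exists>S. xy_center_manifold U (sysfield \<omega> lam f g h) S \<and>
             (\<forall>S'. xy_center_manifold U (sysfield \<omega> lam f g h) S' \<longrightarrow> same_germ0 S S') \<and>
             isochronous_center_family U (sysfield \<omega> lam f g h) S (2 * pi / \<bar>\<omega>\<bar>)"
proof -
  have "\<exists>r C. r > 0 \<and> C > 0 \<and> ball 0 r \<subseteq> U \<and> (\<forall>w. norm w < r \<longrightarrow> norm (F w) \<le> C * (norm w)\<^sup>2)"
    if "holo3 F U" "vanish_order2 F" for F
    using quadratic_bound[OF that(1) assms(4)] that(2) unfolding vanish_order2_def by metis
  from this[OF assms(5,8)] this[OF assms(6,9)] this[OF assms(7,10)]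
  obtain r1 C1 r2 C2 r3 C3 where
    1: "r1 > 0" "C1 > 0" "ball 0 r1 \<subseteq> U" "\<And>w. norm w < r1 \<Longrightarrow> norm (f w) \<le> C1 * (norm w)\<^sup>2" and
    2: "r2 > 0" "C2 > 0" "\<And>w. norm w < r2 \<Longrightarrow> norm (g w) \<le> C2 * (norm w)\<^sup>2" and
    3: "r3 > 0" "C3 > 0" "\<And>w. norm w < r3 \<Longrightarrow> norm (h w) \<le> C3 * (norm w)\<^sup>2"
    by blast
  define C where "C = C1 + C2 + C3"
  define r\<^sub>0 where "r\<^sub>0 = min r1 (min r2 r3)"
  have le: "C1 * (norm w)\<^sup>2 \<le> C * (norm w)\<^sup>2" "C2 * (norm w)\<^sup>2 \<le> C * (norm w)\<^sup>2" "C3 * (norm w)\<^sup>2 \<le> C * (norm w)\<^sup>2"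
    for w :: c3 using 1 2 3 by (auto simp: C_def intro!: mult_right_mono)
  have sub: "ball 0 r\<^sub>0 \<subseteq> U" using 1(3) by (auto simp: r\<^sub>0_def)
  interpret center_field \<omega> lam f g h C r\<^sub>0
  proof
    show "norm (f w) \<le> C * (norm w)\<^sup>2" "norm (g w) \<le> C * (norm w)\<^sup>2" "norm (h w) \<le> C * (norm w)\<^sup>2"
      if "norm w < r\<^sub>0" for w
      using 1(4)[of w] 2(3)[of w] 3(3)[of w] le[of w] that by (auto simp: r\<^sub>0_def)
  qed (use assms 1 2 3 sub holo3_subset[OF _ sub open_ball] in \<open>auto simp: C_def r\<^sub>0_def\<close>)
  obtain R K r a where R: "near_identity R K r a" "16 * a \<le> r\<^sub>0"
    "\<And>u. norm u < a \<Longrightarrow> snd (snd u) = 0 \<Longrightarrow>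
       scaleC3 (\<i> * of_real \<omega>) (dirderiv_map (near_identity.\<Theta> R) u u) = X (near_identity.\<Theta> R u)"
    using linearizing_map by blast
  interpret near_identity R K r a by (fact R(1))
  interpret linearized \<omega> lam f g h C r\<^sub>0 R K r a U
    by unfold_locales (use sub R in auto)
  show ?thesis
    using xy_center_manifold_S same_germ_S isochronous_S by blast
qed

end
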